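(* Let $p$ be a prime, let $F(n)$ be the free pro-$p$ group with generating system $\{x_1,\ldots,x_n\}$, let $K\subseteq\{1,\ldots,n\}$, and let $F(K)$ be the free pro-$p$ group with generating system $\{x_j\mid j\in K\}$ (regarded as the closed subgroup of $F(n)$ generated by these $x_j$). Let $v\in F(n)$ and let $N$ be a closed normal subgroup of $F(n)$. Let $\partial_1,\ldots,\partial_n$ be the Fox derivatives of the completed group ring $\mathbf{Z}_p[[F(n)]]$, and let $\pi:\mathbf{Z}_p[[F(n)]]\to\mathbf{Z}_p[[F(n)/N]]$ be the homomorphism induced by the natural homomorphism $F(n)\to F(n)/N$. If $$\pi(\partial_k(v))=0\quad\text{for all }k\in\{1,\ldots,n\}\setminus K,$$ then $v$ belongs to the closure in $F(n)$ of $F(K)\,(F(K)\cap N)^{F(n)}\,[N,N]$.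
   Context: $\mathbf{Z}_p$ is the ring of $p$-adic integers. For a pro-$p$ group $G$, $\mathbf{Z}_p[[G]]=\varprojlim \mathbf{Z}_p[G/U]$ ($U$ running over open normal subgroups of $G$) is the completed group ring. Fox derivatives: let $F_n$ be the discrete free group on $x_1,\ldots,x_n$, with $F(n)$ its pro-$p$ completion. Let $\varepsilon:\mathbf{Z}[F_n]\to\mathbf{Z}$ be the augmentation. The Fox derivative $D_k$ $(k=1,\ldots,n)$ is the unique additive map $D_k:\mathbf{Z}[F_n]\to\mathbf{Z}[F_n]$ with $D_k(uv)=D_k(u)v+\varepsilon(u)D_k(v)$ for all $u,v$, $D_k(x_k)=1$ and $D_k(x_j)=0$ for $j\ne k$. The ring $\mathbf{Z}_p[[F(n)]]$ is the completion of $\mathbf{Z}[F_n]$ in the topology given by the ideals generated by $p^m$ and $\{1-h\mid h\in N_j\}$, where $m\in\mathbf{N}$ and $N_j$ runs over the normal subgroups of $F_n$ of $p$-power index; the maps $D_k,\varepsilon$ are continuous for this topology, and $\partial_k,\bar\varepsilon$ denote their continuous extensions to $\mathbf{Z}_p[[F(n)]]$. Thus $\partial_k$ is additive and $\partial_k(vw)=\partial_k(v)w+\bar\varepsilon(v)\partial_k(w)$. For a subset $A$ of a group $G$, $A^G$ is the normal subgroup of $G$ generated by $A$; $[N,N]$ is the subgroup generated by all commutators $[a,b]=a^{-1}b^{-1}ab$ with $a,b\in N$; $AB=\{ab\mid a\in A,b\in B\}$. *)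

theory Defs
  imports
    "HOL-Analysis.Function_Topology"
    "HOL-Algebra.Generated_Groups"
    "HOL-Algebra.IntRing"
    "HOL-Computational_Algebra.Primes"
begin

section \<open>Free groups\<close>

text \<open>Elements are reduced words; \<open>(x, True)\<close> stands for \<open>x\<close> and \<open>(x, False)\<close> for its inverse.\<close>

type_synonym 'a word = "('a \<times> bool) list"

fun reduced :: "'a word \<Rightarrow> bool" where
  "reduced ((x, b) # (y, c) # w) \<longleftrightarrow> \<not> (x = y \<and> b \<noteq> c) \<and> reduced ((y, c) # w)"
| "reduced _ \<longleftrightarrow> True"

fun cons_reduce :: "'a \<times> bool \<Rightarrow> 'a word \<Rightarrow> 'a word" where
  "cons_reduce (x, b) ((y, c) # w) = (if x = y \<and> b \<noteq> c then w else (x, b) # (y, c) # w)"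
| "cons_reduce a [] = [a]"

definition free_group :: "'a set \<Rightarrow> 'a word monoid" where
  "free_group X =
    \<lparr>carrier = {w. reduced w \<and> set w \<subseteq> X \<times> UNIV},
     monoid.mult = (\<lambda>u v. foldr cons_reduce u v),
     one = []\<rparr>"

section \<open>The pro-\<open>p\<close> completion of a group\<close>

definition p_index_normals :: "nat \<Rightarrow> ('a, 'm) monoid_scheme \<Rightarrow> 'a set set" where
  "p_index_normals p G = {M. M \<lhd> G \<and> (\<exists>k. card (rcosets\<^bsub>G\<^esub> M) = p ^ k)}"

text \<open>The inverse limit of the quotients \<open>G/M\<close>. For \<open>M \<subseteq> M'\<close> the transition map
  sends the coset \<open>Mg\<close> to the unique coset of \<open>M'\<close> that contains it.\<close>

definition pro_p_completion :: "nat \<Rightarrow> ('a, 'm) monoid_scheme \<Rightarrow> ('a set \<Rightarrow> 'a set) monoid" where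
  "pro_p_completion p G =
    \<lparr>carrier = {f \<in> \<Pi>\<^sub>E M\<in>p_index_normals p G. carrier (G Mod M).
        \<forall>M\<in>p_index_normals p G. \<forall>M'\<in>p_index_normals p G. M \<subseteq> M' \<longrightarrow> f M \<subseteq> f M'},
     monoid.mult = (\<lambda>f g. \<lambda>M\<in>p_index_normals p G. f M <#>\<^bsub>G\<^esub> g M),
     one = (\<lambda>M\<in>p_index_normals p G. M)\<rparr>"

definition pro_p_topology ::
    "nat \<Rightarrow> ('a, 'm) monoid_scheme \<Rightarrow> ('a set \<Rightarrow> 'a set) topology" where
  "pro_p_topology p G =
    subtopology
      (product_topology (\<lambda>M. discrete_topology (carrier (G Mod M))) (p_index_normals p G))
      (carrier (pro_p_completion p G))"

definition to_pro_p :: "nat \<Rightarrow> ('a, 'm) monoid_scheme \<Rightarrow> 'a \<Rightarrow> 'a set \<Rightarrow> 'a set" where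
  "to_pro_p p G g = (\<lambda>M\<in>p_index_normals p G. M #>\<^bsub>G\<^esub> g)"

section \<open>Quotients and normal closures\<close>

definition quotient_topology :: "'a topology \<Rightarrow> ('a \<Rightarrow> 'b) \<Rightarrow> 'b topology" where
  "quotient_topology T q =
    topology (\<lambda>S. S \<subseteq> q ` topspace T \<and> openin T {x \<in> topspace T. q x \<in> S})"

lemma openin_quotient_topology:
  "openin (quotient_topology T q) S \<longleftrightarrow>
    S \<subseteq> q ` topspace T \<and> openin T {x \<in> topspace T. q x \<in> S}"
proof -
  have "istopology (\<lambda>S. S \<subseteq> q ` topspace T \<and> openin T {x \<in> topspace T. q x \<in> S})"
    unfolding istopology_def
  proof (intro conjI allI impI)
    fix S S' assume "S \<subseteq> q ` topspace T \<and> openin T {x \<in> topspace T. q x \<in> S}"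
      and "S' \<subseteq> q ` topspace T \<and> openin T {x \<in> topspace T. q x \<in> S'}"
    moreover have "{x \<in> topspace T. q x \<in> S \<inter> S'} =
        {x \<in> topspace T. q x \<in> S} \<inter> {x \<in> topspace T. q x \<in> S'}" by auto
    ultimately show "S \<inter> S' \<subseteq> q ` topspace T" "openin T {x \<in> topspace T. q x \<in> S \<inter> S'}"
      by auto
  next
    fix \<K> assume K: "\<forall>S\<in>\<K>. S \<subseteq> q ` topspace T \<and> openin T {x \<in> topspace T. q x \<in> S}"
    then show "\<Union>\<K> \<subseteq> q ` topspace T" by blast
    have "{x \<in> topspace T. q x \<in> \<Union>\<K>} = (\<Union>S\<in>\<K>. {x \<in> topspace T. q x \<in> S})" by auto
    then show "openin T {x \<in> topspace T. q x \<in> \<Union>\<K>}" using K by auto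
  qed
  then show ?thesis
    unfolding quotient_topology_def by (simp add: topology_inverse')
qed

definition normal_closure :: "('a, 'm) monoid_scheme \<Rightarrow> 'a set \<Rightarrow> 'a set" where
  "normal_closure G A = (\<lambda>M. M \<lhd> G) hull A"

text \<open>The subgroup \<open>[N, N]\<close> is the library's \<^const>\<open>derived\<close>, which uses the commutators
  \<open>a b a\<inverse> b\<inverse>\<close>; over a subgroup these are the same elements as the \<open>a\<inverse> b\<inverse> a b\<close>.\<close>

section \<open>Group rings\<close>

definition group_ring ::
    "('r, 'n) ring_scheme \<Rightarrow> ('a, 'm) monoid_scheme \<Rightarrow> ('a \<Rightarrow> 'r) ring" where
  "group_ring R G =
    \<lparr>carrier = {f \<in> carrier G \<rightarrow>\<^sub>E carrier R. finite {x \<in> carrier G. f x \<noteq> \<zero>\<^bsub>R\<^esub>}},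
     monoid.mult = (\<lambda>f g. \<lambda>z\<in>carrier G.
        finsum R (\<lambda>x. f x \<otimes>\<^bsub>R\<^esub> g (inv\<^bsub>G\<^esub> x \<otimes>\<^bsub>G\<^esub> z)) {x \<in> carrier G. f x \<noteq> \<zero>\<^bsub>R\<^esub>}),
     one = (\<lambda>z\<in>carrier G. if z = \<one>\<^bsub>G\<^esub> then \<one>\<^bsub>R\<^esub> else \<zero>\<^bsub>R\<^esub>),
     zero = (\<lambda>z\<in>carrier G. \<zero>\<^bsub>R\<^esub>),
     add = (\<lambda>f g. \<lambda>z\<in>carrier G. f z \<oplus>\<^bsub>R\<^esub> g z)\<rparr>"

definition group_ring_of ::
    "('r, 'n) ring_scheme \<Rightarrow> ('a, 'm) monoid_scheme \<Rightarrow> 'a \<Rightarrow> 'a \<Rightarrow> 'r" where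
  "group_ring_of R G g = (\<lambda>z\<in>carrier G. if z = g then \<one>\<^bsub>R\<^esub> else \<zero>\<^bsub>R\<^esub>)"

definition augmentation ::
    "('r, 'n) ring_scheme \<Rightarrow> ('a, 'm) monoid_scheme \<Rightarrow> ('a \<Rightarrow> 'r) \<Rightarrow> 'r" where
  "augmentation R G f = finsum R f {x \<in> carrier G. f x \<noteq> \<zero>\<^bsub>R\<^esub>}"

text \<open>The \<open>R\<close>-linear extension \<open>R[G] \<rightarrow> R[H]\<close> of a group homomorphism \<open>\<phi> : G \<rightarrow> H\<close>.\<close>

definition group_ring_map ::
    "('r, 'n) ring_scheme \<Rightarrow> ('a, 'm) monoid_scheme \<Rightarrow> ('b, 'k) monoid_scheme \<Rightarrow>
     ('a \<Rightarrow> 'b) \<Rightarrow> ('a \<Rightarrow> 'r) \<Rightarrow> 'b \<Rightarrow> 'r" where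
  "group_ring_map R G H \<phi> f =
    (\<lambda>y\<in>carrier H. finsum R f {x \<in> carrier G. f x \<noteq> \<zero>\<^bsub>R\<^esub> \<and> \<phi> x = y})"

section \<open>The \<open>p\<close>-adic integers\<close>

text \<open>The inverse limit of the rings \<open>\<int>/p\<^sup>m\<close>, each represented by \<open>{0..<p\<^sup>m}\<close>.\<close>

definition padic_ring :: "nat \<Rightarrow> (nat \<Rightarrow> int) ring" where
  "padic_ring p =
    \<lparr>carrier = {a. \<forall>m. a m \<in> {0..<int p ^ m} \<and> a (Suc m) mod int p ^ m = a m},
     monoid.mult = (\<lambda>a b m. (a m * b m) mod int p ^ m),
     one = (\<lambda>m. 1 mod int p ^ m),
     zero = (\<lambda>m. 0),
     add = (\<lambda>a b m. (a m + b m) mod int p ^ m)\<rparr>"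

definition padic_topology :: "nat \<Rightarrow> (nat \<Rightarrow> int) topology" where
  "padic_topology p =
    subtopology (product_topology (\<lambda>m. discrete_topology {0..<int p ^ m}) UNIV)
      (carrier (padic_ring p))"

definition padic_of_int :: "nat \<Rightarrow> int \<Rightarrow> nat \<Rightarrow> int" where
  "padic_of_int p k = (\<lambda>m. k mod int p ^ m)"

section \<open>Completed group rings\<close>

type_synonym 'a cgr_elt = "'a set \<Rightarrow> 'a set \<Rightarrow> nat \<Rightarrow> int"

definition open_normals :: "('a, 'm) monoid_scheme \<Rightarrow> 'a topology \<Rightarrow> 'a set set" where
  "open_normals G T = {U. U \<lhd> G \<and> openin T U}"

text \<open>The inverse limit of the rings \<open>\<int>\<^sub>p[G/U]\<close>. For \<open>U \<subseteq> V\<close> the transition map is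
  induced by \<open>G/U \<rightarrow> G/V\<close>, \<open>C \<mapsto> VC\<close>.\<close>

definition completed_group_ring ::
    "nat \<Rightarrow> ('a, 'm) monoid_scheme \<Rightarrow> 'a topology \<Rightarrow> 'a cgr_elt ring" where
  "completed_group_ring p G T =
    (let R = (\<lambda>U. group_ring (padic_ring p) (G Mod U)); I = open_normals G T in
     \<lparr>carrier = {f \<in> \<Pi>\<^sub>E U\<in>I. carrier (R U).
        \<forall>U\<in>I. \<forall>V\<in>I. U \<subseteq> V \<longrightarrow>
          f V = group_ring_map (padic_ring p) (G Mod U) (G Mod V) (\<lambda>C. V <#>\<^bsub>G\<^esub> C) (f U)},
      monoid.mult = (\<lambda>f g. \<lambda>U\<in>I. f U \<otimes>\<^bsub>R U\<^esub> g U),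
      one = (\<lambda>U\<in>I. \<one>\<^bsub>R U\<^esub>),
      zero = (\<lambda>U\<in>I. \<zero>\<^bsub>R U\<^esub>),
      add = (\<lambda>f g. \<lambda>U\<in>I. f U \<oplus>\<^bsub>R U\<^esub> g U)\<rparr>)"

text \<open>Since the groups \<open>G/U\<close> are finite for compact \<open>G\<close>, \<open>\<int>\<^sub>p[G/U]\<close> carries the product
  topology of \<open>\<int>\<^sub>p\<close>. If \<open>G\<close> is the pro-\<open>p\<close> completion of \<open>F\<close>, the topology induced on
  \<open>\<int>[F]\<close> is the one given by the ideals generated by \<open>p\<^sup>m\<close> and \<open>{1 - h | h \<in> M}\<close>, for
  \<open>M\<close> normal of \<open>p\<close>-power index in \<open>F\<close>.\<close>

definition completed_group_ring_topology ::
    "nat \<Rightarrow> ('a, 'm) monoid_scheme \<Rightarrow> 'a topology \<Rightarrow> 'a cgr_elt topology" where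
  "completed_group_ring_topology p G T =
    subtopology
      (product_topology
        (\<lambda>U. product_topology (\<lambda>_. padic_topology p) (carrier (G Mod U))) (open_normals G T))
      (carrier (completed_group_ring p G T))"

definition completed_group_ring_of ::
    "nat \<Rightarrow> ('a, 'm) monoid_scheme \<Rightarrow> 'a topology \<Rightarrow> 'a \<Rightarrow> 'a cgr_elt" where
  "completed_group_ring_of p G T g =
    (\<lambda>U\<in>open_normals G T. group_ring_of (padic_ring p) (G Mod U) (U #>\<^bsub>G\<^esub> g))"

text \<open>The homomorphism \<open>\<int>\<^sub>p[[G]] \<rightarrow> \<int>\<^sub>p[[H]]\<close> induced by a continuous homomorphism
  \<open>\<phi> : G \<rightarrow> H\<close>: its component at \<open>W\<close> comes from \<open>G/\<phi>\<inverse>(W) \<rightarrow> H/W\<close>, \<open>C \<mapsto> W \<phi>(C)\<close>.\<close>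

definition completed_group_ring_map ::
    "nat \<Rightarrow> ('a, 'm) monoid_scheme \<Rightarrow> ('b, 'k) monoid_scheme \<Rightarrow> 'b topology \<Rightarrow> ('a \<Rightarrow> 'b) \<Rightarrow>
     'a cgr_elt \<Rightarrow> 'b cgr_elt" where
  "completed_group_ring_map p G H T \<phi> f =
    (\<lambda>W\<in>open_normals H T.
       let U = {g \<in> carrier G. \<phi> g \<in> W} in
       group_ring_map (padic_ring p) (G Mod U) (H Mod W) (\<lambda>C. W <#>\<^bsub>H\<^esub> \<phi> ` C) (f U))"

section \<open>The free pro-\<open>p\<close> group on \<open>x\<^sub>1, \<dots>, x\<^sub>n\<close>\<close>

type_synonym pro_p_word = "nat word set \<Rightarrow> nat word set"

definition FG :: "nat \<Rightarrow> nat word monoid" where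
  "FG n = free_group {1..n}"

definition FG_gen :: "nat \<Rightarrow> nat word" where
  "FG_gen j = [(j, True)]"

definition ProF :: "nat \<Rightarrow> nat \<Rightarrow> pro_p_word monoid" where
  "ProF p n = pro_p_completion p (FG n)"

definition ProF_top :: "nat \<Rightarrow> nat \<Rightarrow> pro_p_word topology" where
  "ProF_top p n = pro_p_topology p (FG n)"

definition ProF_gen :: "nat \<Rightarrow> nat \<Rightarrow> nat \<Rightarrow> pro_p_word" where
  "ProF_gen p n j = to_pro_p p (FG n) (FG_gen j)"

definition ProF_sub :: "nat \<Rightarrow> nat \<Rightarrow> nat set \<Rightarrow> pro_p_word set" where
  "ProF_sub p n K = ProF_top p n closure_of generate (ProF p n) (ProF_gen p n ` K)"

abbreviation ZpF_top ::
    "nat \<Rightarrow> nat \<Rightarrow> pro_p_word cgr_elt topology" where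
  "ZpF_top p n \<equiv> completed_group_ring_topology p (ProF p n) (ProF_top p n)"

text \<open>The ring homomorphism \<open>\<int>[F\<^sub>n] \<rightarrow> \<int>\<^sub>p[[F(n)]]\<close> that extends \<open>F\<^sub>n \<rightarrow> F(n)\<close>.\<close>

definition ZF_to_ZpF ::
    "nat \<Rightarrow> nat \<Rightarrow> (nat word \<Rightarrow> int) \<Rightarrow> pro_p_word cgr_elt" where
  "ZF_to_ZpF p n a =
    (\<lambda>U\<in>open_normals (ProF p n) (ProF_top p n).
       group_ring_map (padic_ring p) (FG n) (ProF p n Mod U)
         (\<lambda>g. U #>\<^bsub>ProF p n\<^esub> to_pro_p p (FG n) g)
         (\<lambda>g\<in>carrier (FG n). padic_of_int p (a g)))"

text \<open>The quotient \<open>F(n)/N\<close>, its topology, and the homomorphism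
  \<open>\<int>\<^sub>p[[F(n)]] \<rightarrow> \<int>\<^sub>p[[F(n)/N]]\<close> induced by the projection.\<close>

abbreviation ProF_quot_top ::
    "nat \<Rightarrow> nat \<Rightarrow> pro_p_word set \<Rightarrow> pro_p_word set topology" where
  "ProF_quot_top p n N \<equiv> quotient_topology (ProF_top p n) (\<lambda>g. N #>\<^bsub>ProF p n\<^esub> g)"

definition ZpF_proj ::
    "nat \<Rightarrow> nat \<Rightarrow> pro_p_word set \<Rightarrow> pro_p_word cgr_elt \<Rightarrow> pro_p_word set cgr_elt" where
  "ZpF_proj p n N =
    completed_group_ring_map p (ProF p n) (ProF p n Mod N) (ProF_quot_top p n N)
      (\<lambda>g. N #>\<^bsub>ProF p n\<^esub> g)"

section \<open>Fox derivatives\<close>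

definition fox_derivative ::
    "nat \<Rightarrow> nat \<Rightarrow> ((nat word \<Rightarrow> int) \<Rightarrow> (nat word \<Rightarrow> int)) \<Rightarrow> bool" where
  "fox_derivative n k D \<longleftrightarrow>
    (let A = group_ring \<Z> (FG n);
         \<epsilon> = augmentation \<Z> (FG n);
         x = (\<lambda>j. group_ring_of \<Z> (FG n) (FG_gen j)) in
     D \<in> carrier A \<rightarrow> carrier A \<and>
     (\<forall>u\<in>carrier A. \<forall>v\<in>carrier A. D (u \<oplus>\<^bsub>A\<^esub> v) = D u \<oplus>\<^bsub>A\<^esub> D v) \<and>
     (\<forall>u\<in>carrier A. \<forall>v\<in>carrier A.
        D (u \<otimes>\<^bsub>A\<^esub> v) = (D u \<otimes>\<^bsub>A\<^esub> v) \<oplus>\<^bsub>A\<^esub> ([\<epsilon> u] \<cdot>\<^bsub>A\<^esub> D v)) \<and>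
     D (x k) = \<one>\<^bsub>A\<^esub> \<and>
     (\<forall>j\<in>{1..n} - {k}. D (x j) = \<zero>\<^bsub>A\<^esub>))"

text \<open>The continuous extension of \<open>D\<^sub>k\<close>. It is determined on the carrier, because the image of
  \<open>\<int>[F\<^sub>n]\<close> is dense in the Hausdorff space \<open>\<int>\<^sub>p[[F(n)]]\<close>.\<close>

definition completed_fox_derivative ::
    "nat \<Rightarrow> nat \<Rightarrow> nat \<Rightarrow>
      (pro_p_word cgr_elt \<Rightarrow> pro_p_word cgr_elt) \<Rightarrow> bool" where
  "completed_fox_derivative p n k d \<longleftrightarrow>
     continuous_map (ZpF_top p n) (ZpF_top p n) d \<and>
     (\<exists>D. fox_derivative n k D \<and>
        (\<forall>u\<in>carrier (group_ring \<Z> (FG n)). d (ZF_to_ZpF p n u) = ZF_to_ZpF p n (D u)))"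

end

theory Submission
  imports Defs "HOL-Algebra.Elementary_Groups" "HOL-Algebra.SndIsomorphismGrp"
    "HOL-Algebra.Multiplicative_Group" "HOL-Library.Sublist"
begin

text \<open>The proof reads a word as a path. In a quotient \<open>G/L\<close> of a group \<open>G\<close> generated by
  \<open>x\<^sub>1, \<dots>, x\<^sub>n\<close>, the suffixes of a word \<open>w\<close> trace a path from \<open>1\<close> to the class of \<open>w\<close> in the
  Cayley graph, and the coefficient of the Fox derivative \<open>D\<^sub>k(w)\<close> at a class \<open>C\<close> counts, with sign,
  the passages through the edge from \<open>C\<close> to \<open>x\<^sub>k C\<close>. Choose representatives \<open>s(C)\<close> of the classes. Then
  \<open>s(w)\<inverse> w s(1)\<close> telescopes into a product of the elements \<open>s(x\<^sub>k C)\<inverse> x\<^sub>k s(C)\<close> of \<open>L\<close> and their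
  inverses, one for each step of the path. In an abelian quotient of \<open>L\<close> of exponent \<open>q\<close> only the
  signed counts modulo \<open>q\<close> matter, so the edges with \<open>k \<notin> K\<close> disappear if \<open>q\<close> divides their counts.
  If the representatives are moreover chosen compatibly with left multiplication by the subgroup
  \<open>H\<close> that contains the \<open>x\<^sub>k\<close> with \<open>k \<in> K\<close>, the remaining factors are conjugates of elements of \<open>H \<inter> L\<close>.
  Counting modulo \<open>q\<close> also shows that \<open>w\<close> lies in \<open>H L\<close>, so that \<open>s(w)\<close> and \<open>s(1)\<close> differ by an element of \<open>H\<close>.
  Hence \<open>w\<close> lies in \<open>H B\<close> for every normal \<open>B \<subseteq> L\<close> that contains \<open>[L, L]\<close>, the \<open>q\<close>-th powers of
  elements of \<open>L\<close>, and \<open>H \<inter> L\<close>. This is lemma \<open>word_in_product_if_counts_vanish\<close>.\<close>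

text \<open>The passage to the pro-\<open>p\<close> group \<open>F(n)\<close> is an approximation argument. Fix a level, that is, an
  open normal subgroup \<open>U\<close>. By compactness there is a smaller open normal \<open>U'\<close> such that
  \<open>F(K) \<inter> N U'\<close> is contained in \<open>(F(K) \<inter> N) U\<close> (lemma \<open>compact_intersection\<close>).
  Write \<open>G = F(n)\<close>, take \<open>L = N U'\<close>, and for \<open>q > 1\<close> a power of \<open>p\<close> that kills \<open>G/U\<close>;
  then the lemma above applies with
  \<open>B\<close> the intersection of \<open>L\<close> with \<open>(F(K) \<inter> N)\<^sup>G [N, N] U\<close> (lemma \<open>word_near_product\<close>). Since
  \<open>G/L\<close> is also a quotient of \<open>F(n)/N\<close>, the assumption on \<open>v\<close> says that the coefficients of \<open>\<partial>\<^sub>k(v)\<close> at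
  level \<open>L\<close> vanish for \<open>k \<notin> K\<close>. The map \<open>\<partial>\<^sub>k\<close> is continuous and words are dense, so some word \<open>w\<close>
  agrees with \<open>v\<close> modulo \<open>U\<close> and has all those coefficients divisible by \<open>q\<close>. So \<open>w\<close>, and with it
  \<open>v\<close>, agrees modulo \<open>U\<close> with an element of \<open>F(K) (F(K) \<inter> N)\<^sup>G [N, N]\<close>. As \<open>U\<close> was arbitrary,
  \<open>v\<close> lies in the closure.\<close>

section \<open>Words as paths\<close>

fun word_value :: "('g, 'm) monoid_scheme \<Rightarrow> ('a \<Rightarrow> 'g) \<Rightarrow> 'a word \<Rightarrow> 'g" where
  "word_value G x [] = \<one>\<^bsub>G\<^esub>"
| "word_value G x ((j, b) # u) = (if b then x j else inv\<^bsub>G\<^esub> x j) \<otimes>\<^bsub>G\<^esub> word_value G x u"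

lemma (in group) word_value_closed:
  assumes "x \<in> X \<rightarrow> carrier G" "set w \<subseteq> X \<times> UNIV"
  shows "word_value G x w \<in> carrier G"
  using assms(2)
proof (induction w)
  case (Cons a u)
  obtain j b where "a = (j, b)" by force
  with Cons assms(1) show ?case by auto
qed simp

text \<open>The suffixes of a word, read from right to left, form a path: prepending \<open>x\<^sub>k\<close> to \<open>u\<close> passes the
  \<open>k\<close>-edge at \<open>u\<close> forwards, prepending \<open>x\<^sub>k\<inverse>\<close> passes the \<open>k\<close>-edge at \<open>x\<^sub>k\<inverse> u\<close> backwards. This counts, with
  sign, the passages through the \<open>k\<close>-edges at the vertices of class \<open>C\<close>. If \<open>cls\<close> is the identity,
  these are the coefficients of the \<open>k\<close>-th Fox derivative of the word.\<close>

fun fox_count :: "('a word \<Rightarrow> 'c) \<Rightarrow> 'a \<Rightarrow> 'a word \<Rightarrow> 'c \<Rightarrow> int" where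
  "fox_count cls k [] C = 0"
| "fox_count cls k ((j, b) # u) C =
    (if j = k then if b then of_bool (cls u = C) else - of_bool (cls ((j, b) # u) = C) else 0)
      + fox_count cls k u C"

text \<open>If a function of words changes along each edge by a factor that depends only on the label and
  the class of the edge, then in an abelian group the order of the passages is irrelevant, and only
  the signed counts enter. Both the projection of a word to \<open>G/HL\<close> and the telescoping product in
  \<open>L/B\<close> are of this kind.\<close>

lemma (in comm_group) cocycle_eq_finprod:
  assumes fin: "finite X" "finite J"
    and E: "\<And>j C. j \<in> X \<Longrightarrow> C \<in> J \<Longrightarrow> E j C \<in> carrier G"
    and cls: "\<And>u. set u \<subseteq> X \<times> UNIV \<Longrightarrow> cls u \<in> J"
    and one: "\<Psi> [] = \<one>"
    and step: "\<And>j b u. set ((j, b) # u) \<subseteq> X \<times> UNIV \<Longrightarrow>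
      \<Psi> ((j, b) # u) = (if b then E j (cls u) else inv E j (cls ((j, b) # u))) \<otimes> \<Psi> u"
    and w: "set w \<subseteq> X \<times> UNIV"
  shows "\<Psi> w = (\<Otimes>z\<in>X \<times> J. case z of (k, C) \<Rightarrow> E k C [^] fox_count cls k w C)"
  using w
proof (induction w)
  case Nil
  then show ?case by (simp add: one case_prod_unfold)
next
  case (Cons a u)
  obtain j b where a: "a = (j, b)" by force
  have j: "j \<in> X" and u: "set u \<subseteq> X \<times> UNIV" using Cons.prems a by auto
  define D where "D = (if b then cls u else cls (a # u))"
  define \<sigma> :: int where "\<sigma> = (if b then 1 else -1)"
  have D: "D \<in> J" using cls u Cons.prems by (auto simp: D_def)
  \<comment> \<open>The step from \<open>u\<close> to \<open>a # u\<close> passes the single edge \<open>(j, D)\<close>, in the direction \<open>\<sigma>\<close>.\<close>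
  have cnt: "fox_count cls k (a # u) C = (if (k, C) = (j, D) then \<sigma> else 0) + fox_count cls k u C"
    for k C by (auto simp: a D_def \<sigma>_def)
  have "(\<Otimes>z\<in>X \<times> J. case z of (k, C) \<Rightarrow> E k C [^] fox_count cls k (a # u) C) =
      (\<Otimes>z\<in>X \<times> J. (if z = (j, D) then (case z of (k, C) \<Rightarrow> E k C [^] \<sigma>) else \<one>)
         \<otimes> (case z of (k, C) \<Rightarrow> E k C [^] fox_count cls k u C))"
    by (rule finprod_cong') (use E in \<open>auto simp: cnt int_pow_mult split: if_splits\<close>)
  also have "\<dots> = (\<Otimes>z\<in>X \<times> J. if z = (j, D) then (case z of (k, C) \<Rightarrow> E k C [^] \<sigma>) else \<one>)
      \<otimes> (\<Otimes>z\<in>X \<times> J. case z of (k, C) \<Rightarrow> E k C [^] fox_count cls k u C)"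
    by (rule finprod_multf) (use E in auto)
  also have "(\<Otimes>z\<in>X \<times> J. if z = (j, D) then (case z of (k, C) \<Rightarrow> E k C [^] \<sigma>) else \<one>) = E j D [^] \<sigma>"
    by (subst finprod_singleton_swap) (use E j D fin in auto)
  also have "E j D [^] \<sigma> = (if b then E j (cls u) else inv E j (cls ((j, b) # u)))"
    using E[OF j D] by (cases b) (simp_all add: D_def \<sigma>_def a int_pow_neg)
  finally have "(\<Otimes>z\<in>X \<times> J. case z of (k, C) \<Rightarrow> E k C [^] fox_count cls k (a # u) C) =
      (if b then E j (cls u) else inv E j (cls ((j, b) # u))) \<otimes> \<Psi> u"
    unfolding Cons.IH[OF u] .
  moreover have "\<Psi> (a # u) = (if b then E j (cls u) else inv E j (cls ((j, b) # u))) \<otimes> \<Psi> u"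
    using step[of j b u] Cons.prems by (simp only: a)
  ultimately show ?case by (rule trans[OF _ sym, rotated])
qed

lemma (in comm_group) cocycle_trivial:
  assumes "finite X" "finite J"
    and "\<And>j C. j \<in> X \<Longrightarrow> C \<in> J \<Longrightarrow> E j C \<in> carrier G"
    and "\<And>u. set u \<subseteq> X \<times> UNIV \<Longrightarrow> cls u \<in> J"
    and "\<Psi> [] = \<one>"
    and "\<And>j b u. set ((j, b) # u) \<subseteq> X \<times> UNIV \<Longrightarrow>
      \<Psi> ((j, b) # u) = (if b then E j (cls u) else inv E j (cls ((j, b) # u))) \<otimes> \<Psi> u"
    and "set w \<subseteq> X \<times> UNIV"
    and K: "\<And>k C. k \<in> K \<Longrightarrow> C \<in> J \<Longrightarrow> E k C = \<one>"
    and q: "\<And>k C. k \<in> X - K \<Longrightarrow> C \<in> J \<Longrightarrow> E k C [^] q = \<one>"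
    and dvd: "\<And>k C. k \<in> X - K \<Longrightarrow> C \<in> J \<Longrightarrow> int q dvd fox_count cls k w C"
  shows "\<Psi> w = \<one>"
proof -
  have "E k C [^] fox_count cls k w C = \<one>" if k: "k \<in> X" and C: "C \<in> J" for k C
  proof (cases "k \<in> K")
    case True
    then show ?thesis using K[OF True C] by simp
  next
    case False
    then have "k \<in> X - K" using k by simp
    from dvd[OF this C] obtain t where t: "fox_count cls k w C = int q * t" by (rule dvdE)
    have "E k C [^] (int q * t) = (E k C [^] int q) [^] t"
      using int_pow_pow[OF assms(3)[OF k C]] by (rule sym)
    also have "E k C [^] int q = \<one>" using q[OF \<open>k \<in> X - K\<close> C] by (simp only: int_pow_int)
    finally show ?thesis by (simp only: t int_pow_one)
  qed
  then have "(\<Otimes>z\<in>X \<times> J. case z of (k, C) \<Rightarrow> E k C [^] fox_count cls k w C) = \<one>"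
    by (intro finprod_one_eqI) (simp only: split_paired_all mem_Sigma_iff prod.case)
  then show ?thesis by (subst cocycle_eq_finprod[OF assms(1-7)])
qed

section \<open>Words whose counts vanish modulo a normal subgroup\<close>

lemma mem_set_mult: "a \<in> A \<Longrightarrow> b \<in> B \<Longrightarrow> a \<otimes>\<^bsub>G\<^esub> b \<in> A <#>\<^bsub>G\<^esub> B"
  unfolding set_mult_def by blast

lemma (in group) inv_cancel:
  assumes "a \<in> carrier G" "b \<in> carrier G"
  shows "inv a \<otimes> (a \<otimes> b) = b" and "a \<otimes> (inv a \<otimes> b) = b"
  using assms by (simp_all add: m_assoc[symmetric])

text \<open>Cosets of \<open>L\<close> in one orbit under left multiplication by \<open>H\<close> have the same product \<open>HC\<close>. Choosing
  one element \<open>r\<close> of each such product and looking for representatives of the form \<open>hr\<close> makes the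
  choice compatible with \<open>H\<close>, although it is not equivariant.\<close>

lemma (in group) coset_section_exists:
  assumes H: "subgroup H G" and L: "L \<lhd> G"
  obtains s where "\<And>g. g \<in> carrier G \<Longrightarrow> s (L #> g) \<in> L #> g"
    and "\<And>g h. g \<in> carrier G \<Longrightarrow> h \<in> H \<Longrightarrow> \<exists>h'\<in>H. s (L #> (h \<otimes> g)) = h' \<otimes> s (L #> g)"
proof -
  interpret H: subgroup H G by fact
  interpret L: normal L G by fact
  define r where "r C = (SOME y. y \<in> H <#> C)" for C
  define s where "s C = (SOME y. y \<in> C \<and> (\<exists>h\<in>H. y = h \<otimes> r C))" for C
  have s: "s (L #> g) \<in> L #> g \<and> (\<exists>h\<in>H. s (L #> g) = h \<otimes> r (L #> g))" if g: "g \<in> carrier G" for g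
    unfolding s_def
  proof (rule someI_ex)
    have "\<one> \<otimes> g \<in> H <#> (L #> g)"
      using rcos_self[OF g L.is_subgroup] by (intro mem_set_mult H.one_closed)
    then have "r (L #> g) \<in> H <#> (L #> g)" unfolding r_def by (rule someI)
    then obtain h c where hc: "h \<in> H" "c \<in> L #> g" "r (L #> g) = h \<otimes> c"
      by (auto simp: set_mult_def)
    have "c \<in> carrier G" using hc(2) g L.subset r_coset_subset_G by blast
    then have "c = inv h \<otimes> r (L #> g)" using hc by (simp add: m_assoc[symmetric])
    then show "\<exists>y. y \<in> L #> g \<and> (\<exists>h\<in>H. y = h \<otimes> r (L #> g))" using hc by blast
  qed
  have sub: "H <#> (L #> (h \<otimes> g)) \<subseteq> H <#> (L #> g)" if "g \<in> carrier G" "h \<in> H" for g h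
  proof
    fix y assume "y \<in> H <#> (L #> (h \<otimes> g))"
    then obtain h1 l where *: "h1 \<in> H" "l \<in> L" "y = h1 \<otimes> (l \<otimes> (h \<otimes> g))"
      by (auto simp: set_mult_def r_coset_def)
    have "y = (h1 \<otimes> h) \<otimes> ((inv h \<otimes> l \<otimes> h) \<otimes> g)"
      using * that by (simp add: m_assoc inv_cancel)
    moreover have "inv h \<otimes> l \<otimes> h \<in> L" using L.inv_op_closed1 * that by simp
    ultimately show "y \<in> H <#> (L #> g)"
      using * that unfolding set_mult_def r_coset_def by blast
  qed
  have r: "r (L #> (h \<otimes> g)) = r (L #> g)" if "g \<in> carrier G" "h \<in> H" for g h
  proof -
    have "H <#> (L #> (inv h \<otimes> (h \<otimes> g))) \<subseteq> H <#> (L #> (h \<otimes> g))"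
      by (rule sub) (use that in auto)
    then have "H <#> (L #> (h \<otimes> g)) = H <#> (L #> g)"
      using sub[OF that] that by (simp add: m_assoc[symmetric])
    then show ?thesis by (simp add: r_def)
  qed
  have "\<exists>h'\<in>H. s (L #> (h \<otimes> g)) = h' \<otimes> s (L #> g)" if g: "g \<in> carrier G" and h: "h \<in> H" for g h
  proof -
    obtain h1 where h1: "h1 \<in> H" "s (L #> (h \<otimes> g)) = h1 \<otimes> r (L #> g)"
      using s[of "h \<otimes> g"] r[OF g h] g h by auto
    obtain h2 where h2: "h2 \<in> H" "s (L #> g) = h2 \<otimes> r (L #> g)"
      using s[OF g] by auto
    have "s (L #> g) \<in> carrier G" using s[OF g] g L.subset r_coset_subset_G by blast
    moreover have "r (L #> g) \<in> carrier G"
    proof -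
      have "\<one> \<otimes> g \<in> H <#> (L #> g)"
        using rcos_self[OF g L.is_subgroup] by (intro mem_set_mult H.one_closed)
      then have "r (L #> g) \<in> H <#> (L #> g)" unfolding r_def by (rule someI)
      then show ?thesis
        using setmult_subset_G[OF H.subset r_coset_subset_G[OF L.subset g]] by blast
    qed
    ultimately have "s (L #> (h \<otimes> g)) = (h1 \<otimes> inv h2) \<otimes> s (L #> g)"
      using h1 h2 by (simp add: m_assoc inv_cancel)
    then show ?thesis using h1 h2 by blast
  qed
  show thesis
  proof (rule that)
    show "s (L #> g) \<in> L #> g" if "g \<in> carrier G" for g using s[OF that] by (rule conjunct1)
  qed fact
qed

lemma (in group) comm_group_Mod_if_derived:
  assumes L: "L \<lhd> G" and B: "B \<lhd> G" and BL: "B \<subseteq> L" and der: "derived G L \<subseteq> B"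
  shows "comm_group (G\<lparr>carrier := L\<rparr> Mod B)"
proof -
  interpret L: normal L G by fact
  interpret B: normal B G by fact
  have "B \<lhd> G\<lparr>carrier := L\<rparr>" using normal_restrict_supergroup L.is_subgroup B BL by blast
  then interpret Q: group "G\<lparr>carrier := L\<rparr> Mod B" by (rule normal.factorgroup_is_group)
  show ?thesis
  proof (rule Q.group_comm_groupI)
    fix C D assume "C \<in> carrier (G\<lparr>carrier := L\<rparr> Mod B)" "D \<in> carrier (G\<lparr>carrier := L\<rparr> Mod B)"
    then obtain a b where ab: "a \<in> L" "b \<in> L" "C = B #> a" "D = B #> b"
      by (auto simp: carrier_FactGroup)
    then have c: "a \<in> carrier G" "b \<in> carrier G" by auto
    have "a \<otimes> b \<otimes> inv a \<otimes> inv b \<in> derived G L"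
      unfolding derived_def by (rule generate.incl) (use ab in blast)
    then have "a \<otimes> b \<otimes> inv a \<otimes> inv b \<in> B" using der by blast
    moreover have "a \<otimes> b \<otimes> inv a \<otimes> inv b = (a \<otimes> b) \<otimes> inv (b \<otimes> a)"
      using c by (simp add: inv_mult_group m_assoc)
    ultimately have "B #> (a \<otimes> b) = B #> (b \<otimes> a)"
      using B.rcos_module_rev[OF is_group, of "b \<otimes> a" "a \<otimes> b"] c
      by (metis m_closed repr_independence B.is_subgroup)
    then show "C \<otimes>\<^bsub>G\<lparr>carrier := L\<rparr> Mod B\<^esub> D = D \<otimes>\<^bsub>G\<lparr>carrier := L\<rparr> Mod B\<^esub> C"
      using ab c by (simp add: B.rcos_sum)
  qed
qed

text \<open>The algebraic core. The smallest possible \<open>B\<close> is the product of \<open>[L, L]\<close>, the group of \<open>q\<close>-th powers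
  and the normal closure of \<open>H \<inter> L\<close>. Cocycles are used twice: with values in \<open>\<int>/q\<close> to see that the path
  of \<open>w\<close> ends in the \<open>H\<close>-orbit in which it starts, and with values in \<open>L/B\<close> to see that the
  telescoping product is trivial.\<close>

lemma (in group) word_in_product_if_counts_vanish:
  assumes X: "finite X" "x \<in> X \<rightarrow> carrier G" and H: "subgroup H G" "x ` K \<subseteq> H"
    and L: "L \<lhd> G" "finite (carrier (G Mod L))"
    and B: "B \<lhd> G" "B \<subseteq> L" "derived G L \<subseteq> B" "H \<inter> L \<subseteq> B" "\<And>a. a \<in> L \<Longrightarrow> a [^] q \<in> B"
    and "K \<subseteq> X" and q: "q > (1::nat)"
    and w: "set w \<subseteq> X \<times> UNIV"
    and dvd: "\<And>k C. k \<in> X - K \<Longrightarrow> C \<in> carrier (G Mod L) \<Longrightarrow>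
      int q dvd fox_count (\<lambda>u. L #> word_value G x u) k w C"
  shows "word_value G x w \<in> H <#> B"
proof -
  interpret H: subgroup H G by fact
  interpret L: normal L G by fact
  interpret B: normal B G by fact
  define cls where "cls u = L #> word_value G x u" for u
  let ?J = "carrier (G Mod L)"
  obtain s where s: "\<And>g. g \<in> carrier G \<Longrightarrow> s (L #> g) \<in> L #> g"
    and sH: "\<And>g h. g \<in> carrier G \<Longrightarrow> h \<in> H \<Longrightarrow> \<exists>h'\<in>H. s (L #> (h \<otimes> g)) = h' \<otimes> s (L #> g)"
    using coset_section_exists[OF H(1) L(1)] by metis
  have sG: "s (L #> g) \<in> carrier G" if "g \<in> carrier G" for g
    using s that L.subset r_coset_subset_G by blast
  have Ls: "L #> s (L #> g) = L #> g" if "g \<in> carrier G" for g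
    using s[OF that] that L.is_subgroup by (metis repr_independence)
  have LsC: "L #> (a \<otimes> s (L #> g)) = L #> (a \<otimes> g)" if "g \<in> carrier G" "a \<in> carrier G" for a g
    using that sG Ls by (metis L.rcos_sum)
  have val: "word_value G x u \<in> carrier G" if "set u \<subseteq> X \<times> UNIV" for u
    using word_value_closed X(2) that by blast
  have xG: "x j \<in> carrier G" if "j \<in> X" for j using X(2) that by blast
  have clsJ: "cls u \<in> ?J" if "set u \<subseteq> X \<times> UNIV" for u
    using val[OF that] by (auto simp: cls_def carrier_FactGroup)
  have dvd': "int q dvd fox_count cls k w C" if "k \<in> X - K" "C \<in> ?J" for k C
    using dvd that by (simp add: cls_def[abs_def])
  \<comment> \<open>The indicator function of the orbit of \<open>1\<close> does not change along the edges with label in \<open>K\<close>,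
    and the other edges contribute multiples of \<open>q\<close>. So it takes the same value at \<open>1\<close> and at \<open>w\<close>
    modulo \<open>q\<close>, hence the same value, as \<open>q > 1\<close>.\<close>
  have wHL: "\<exists>h\<in>H. cls w = L #> h"
  proof -
    define \<phi> :: "'a set \<Rightarrow> int" where "\<phi> C = of_bool (\<exists>h\<in>H. C = L #> h)" for C
    interpret Z: comm_group "integer_mod_group q" by simp
    have sub: "\<exists>h1\<in>H. L #> (h \<otimes> g) = L #> h1" if "g \<in> carrier G" "h \<in> H" "\<exists>h\<in>H. L #> g = L #> h" for g h
      using that by (metis L.rcos_sum H.m_closed H.mem_carrier)
    have \<phi>H: "\<phi> (L #> (h \<otimes> g)) = \<phi> (L #> g)" if "g \<in> carrier G" "h \<in> H" for g h
    proof -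
      have "inv h \<otimes> (h \<otimes> g) = g" using that by (simp add: m_assoc[symmetric])
      then have "(\<exists>h1\<in>H. L #> (h \<otimes> g) = L #> h1) = (\<exists>h1\<in>H. L #> g = L #> h1)"
        using sub[OF that] sub[of "h \<otimes> g" "inv h"] that by auto
      then show ?thesis by (simp add: \<phi>_def)
    qed
    have car: "carrier (integer_mod_group q) = {0..<int q}"
      using q by (simp add: integer_mod_group_def)
    have "(\<phi> (cls w) - \<phi> (cls [])) mod int q = \<one>\<^bsub>integer_mod_group q\<^esub>"
    proof (rule Z.cocycle_trivial[where cls = cls and X = X and J = ?J and K = K and q = q
          and E = "\<lambda>j C. (\<phi> (L #> (x j \<otimes> s C)) - \<phi> C) mod int q"
          and \<Psi> = "\<lambda>u. (\<phi> (cls u) - \<phi> (cls [])) mod int q"])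
      fix j b u assume ju: "set ((j, b) # u) \<subseteq> X \<times> (UNIV :: bool set)"
      then have j: "j \<in> X" and u: "set u \<subseteq> X \<times> (UNIV :: bool set)" by auto
      show "(\<phi> (cls ((j, b) # u)) - \<phi> (cls [])) mod int q =
         (if b then (\<phi> (L #> (x j \<otimes> s (cls u))) - \<phi> (cls u)) mod int q
          else inv\<^bsub>integer_mod_group q\<^esub> ((\<phi> (L #> (x j \<otimes> s (cls ((j, b) # u)))) - \<phi> (cls ((j, b) # u))) mod int q))
         \<otimes>\<^bsub>integer_mod_group q\<^esub> ((\<phi> (cls u) - \<phi> (cls [])) mod int q)"
      proof (cases b)
        case True
        then show ?thesis
          using LsC[OF val[OF u] xG[OF j]] by (simp add: cls_def mult_integer_mod_group mod_simps)
      next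
        case False
        have "L #> (x j \<otimes> s (cls ((j, b) # u))) = cls u"
          using False LsC[of "inv x j \<otimes> word_value G x u" "x j"] val[OF u] xG[OF j]
          by (simp add: cls_def m_assoc[symmetric])
        then show ?thesis
          using False q by (simp add: inv_integer_mod_group car mult_integer_mod_group mod_simps)
      qed
    next
      fix k C assume "k \<in> K" "C \<in> ?J"
      then obtain g where g: "g \<in> carrier G" "C = L #> g" by (auto simp: carrier_FactGroup)
      have "x k \<in> H" using H(2) \<open>k \<in> K\<close> by blast
      then show "(\<phi> (L #> (x k \<otimes> s C)) - \<phi> C) mod int q = \<one>\<^bsub>integer_mod_group q\<^esub>"
        using g \<phi>H[of "s C" "x k"] sG Ls by simp
    qed (use X L clsJ w q dvd' in \<open>auto simp: car pow_integer_mod_group\<close>)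
    moreover have "\<phi> (cls []) = 1" by (auto simp: \<phi>_def cls_def)
    ultimately have "\<phi> (cls w) \<noteq> 0" using q by (auto simp: zmod_minus1)
    then show ?thesis by (auto simp: \<phi>_def split: if_splits)
  qed
  let ?Q = "G\<lparr>carrier := L\<rparr> Mod B"
  interpret Q: comm_group ?Q using comm_group_Mod_if_derived L(1) B by blast
  have carQ: "carrier ?Q = (\<lambda>a. B #> a) ` L" by (simp add: carrier_FactGroup)
  have invQ: "inv\<^bsub>?Q\<^esub> (B #> a) = B #> inv a" if "a \<in> L" for a
    using that by (intro Q.inv_equality) (auto simp: carQ B.rcos_sum B.subset)
  have powQ: "(B #> a) [^]\<^bsub>?Q\<^esub> (m::nat) = B #> (a [^] m)" if "a \<in> L" for a m
    using that by (induction m) (auto simp: B.rcos_sum B.subset)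
  \<comment> \<open>The contribution of the edge \<open>(j, C)\<close> to the telescoping product \<open>t u\<close> below.\<close>
  define e where "e j C = inv s (L #> (x j \<otimes> s C)) \<otimes> x j \<otimes> s C" for j C
  have eL: "e j C \<in> L" if "j \<in> X" and C: "C \<in> ?J" for j C
  proof -
    obtain g where g: "g \<in> carrier G" "C = L #> g" using C by (auto simp: carrier_FactGroup)
    let ?a = "x j \<otimes> s C"
    have a: "?a \<in> carrier G" using g sG xG that by simp
    have "L #> s (L #> ?a) = L #> ?a" using Ls a by simp
    then have "L #> (inv s (L #> ?a) \<otimes> ?a) = L #> (inv ?a \<otimes> ?a)"
      using a sG by (metis L.rcos_sum inv_closed l_inv)
    then have "L #> e j C = L"
      using a g sG xG that by (simp add: e_def m_assoc L.subset)
    moreover have "e j C \<in> carrier G" using a g sG xG that by (simp add: e_def)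
    ultimately show ?thesis using L.is_subgroup coset_join1 L.subset by metis
  qed
  define t where "t u = inv s (cls u) \<otimes> word_value G x u \<otimes> s (cls [])" for u
  have "B #> t w = \<one>\<^bsub>?Q\<^esub>"
  proof (rule Q.cocycle_trivial[where cls = cls and X = X and J = ?J and K = K and q = q
        and E = "\<lambda>j C. B #> e j C" and \<Psi> = "\<lambda>u. B #> t u"])
    show "B #> t [] = \<one>\<^bsub>?Q\<^esub>"
      using sG by (simp add: t_def cls_def B.subset)
  next
    fix j b u assume ju: "set ((j, b) # u) \<subseteq> X \<times> (UNIV :: bool set)"
    then have j: "j \<in> X" and u: "set u \<subseteq> X \<times> (UNIV :: bool set)" by auto
    have c: "word_value G x u \<in> carrier G" "x j \<in> carrier G" "s (cls u) \<in> carrier G"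
      "s (cls ((j, b) # u)) \<in> carrier G" "s (cls []) \<in> carrier G"
      using val[OF u] val[OF ju] xG[OF j] sG unfolding cls_def by auto
    let ?e = "if b then e j (cls u) else inv e j (cls ((j, b) # u))"
    have "t ((j, b) # u) = ?e \<otimes> t u"
    proof (cases b)
      case True
      then have "e j (cls u) = inv s (cls ((j, b) # u)) \<otimes> x j \<otimes> s (cls u)"
        using LsC[OF val[OF u] xG[OF j]] by (simp add: cls_def e_def)
      then show ?thesis using c True by (simp add: t_def m_assoc inv_cancel)
    next
      case False
      have "L #> (x j \<otimes> s (cls ((j, b) # u))) = cls u"
        using False LsC[of "inv x j \<otimes> word_value G x u" "x j"] val[OF u] xG[OF j]
        by (simp add: cls_def m_assoc[symmetric])
      then have "inv e j (cls ((j, b) # u)) = inv s (cls ((j, b) # u)) \<otimes> inv x j \<otimes> s (cls u)"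
        using c by (simp add: e_def inv_mult_group m_assoc)
      then show ?thesis using c False by (simp add: t_def m_assoc inv_cancel)
    qed
    moreover have "?e \<in> L" using eL j clsJ u ju by auto
    moreover have "t u \<in> carrier G" using c by (simp add: t_def)
    ultimately show "B #> t ((j, b) # u) =
        (if b then B #> e j (cls u) else inv\<^bsub>?Q\<^esub> (B #> e j (cls ((j, b) # u)))) \<otimes>\<^bsub>?Q\<^esub> (B #> t u)"
      using eL j clsJ[OF ju] by (auto simp: invQ B.rcos_sum)
  next
    \<comment> \<open>Compatibility of \<open>s\<close> with \<open>H\<close> turns this edge into a conjugate of an element of \<open>H \<inter> L\<close>.\<close>
    fix k C assume k: "k \<in> K" and C: "C \<in> ?J"
    then obtain g where g: "g \<in> carrier G" "C = L #> g" by (auto simp: carrier_FactGroup)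
    have xk: "x k \<in> H" "k \<in> X" using H(2) k \<open>K \<subseteq> X\<close> by auto
    have sC: "s C \<in> carrier G" "L #> s C = C" using g sG Ls by auto
    obtain h where h: "h \<in> H" "s (L #> (x k \<otimes> s C)) = h \<otimes> s C"
      using sH[OF sC(1) xk(1)] sC by auto
    have ek: "e k C = inv s C \<otimes> (inv h \<otimes> x k) \<otimes> s C"
      using h xk sC by (simp add: e_def inv_mult_group m_assoc)
    moreover have "e k C \<in> carrier G" using eL[OF xk(2) C] by simp
    ultimately have "inv h \<otimes> x k = s C \<otimes> e k C \<otimes> inv s C"
      using h xk sC by (simp add: m_assoc inv_cancel)
    then have "inv h \<otimes> x k \<in> L" using L.inv_op_closed2 sC eL[OF xk(2) C] by simp
    then have "inv h \<otimes> x k \<in> B" using B h xk by blast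
    then have "e k C \<in> B" using B.inv_op_closed1 sC ek by simp
    then show "B #> e k C = \<one>\<^bsub>?Q\<^esub>" using B.rcos_const by simp
  next
    fix k C assume "k \<in> X - K" and C: "C \<in> ?J"
    then have "e k C \<in> L" using eL by auto
    then show "(B #> e k C) [^]\<^bsub>?Q\<^esub> q = \<one>\<^bsub>?Q\<^esub>"
      using B.rcos_const[OF is_group B(5)] by (simp add: powQ)
  qed (use X L clsJ w dvd' eL in \<open>auto simp: carQ\<close>)
  \<comment> \<open>As \<open>w\<close> and \<open>1\<close> are in one \<open>H\<close>-orbit, \<open>s(w) = h' s(1)\<close>; so \<open>h'\<inverse> w\<close> is a conjugate of \<open>t w\<close>.\<close>
  then have Bt: "B #> t w = B" by simp
  obtain h where h: "h \<in> H" "cls w = L #> h" using wHL by blast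
  obtain h' where h': "h' \<in> H" "s (cls w) = h' \<otimes> s (cls [])"
    using sH[of \<one> h] h by (auto simp: cls_def)
  have c: "word_value G x w \<in> carrier G" "s (cls []) \<in> carrier G"
    using val[OF w] sG by (auto simp: cls_def)
  have t: "t w = inv s (cls []) \<otimes> (inv h' \<otimes> word_value G x w) \<otimes> s (cls [])"
    using c h' by (simp add: t_def inv_mult_group m_assoc)
  have tB: "t w \<in> B"
    using coset_join1[OF Bt _ B.is_subgroup] t c h' by simp
  have "inv h' \<otimes> word_value G x w = s (cls []) \<otimes> t w \<otimes> inv s (cls [])"
    using t c h' by (simp add: m_assoc inv_cancel)
  then have "inv h' \<otimes> word_value G x w \<in> B" using B.inv_op_closed2 c tB by simp
  moreover have "word_value G x w = h' \<otimes> (inv h' \<otimes> word_value G x w)"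
    using c h' by (simp add: m_assoc[symmetric])
  ultimately show ?thesis using h' unfolding set_mult_def by blast
qed

section \<open>Free groups as groups of reduced words\<close>

lemma reduced_tl: "reduced (a # w) \<Longrightarrow> reduced w"
  by (cases a; cases w) auto

lemma cons_reduce_reduced: "reduced (a # w) \<Longrightarrow> cons_reduce a w = a # w"
  by (cases a; cases w) auto

lemma reduced_cons_reduce: "reduced w \<Longrightarrow> reduced (cons_reduce a w)"
  by (cases a; cases w) (auto dest: reduced_tl)

lemma cons_reduce_cancel: "reduced w \<Longrightarrow> cons_reduce (x, b) (cons_reduce (x, \<not> b) w) = w"
  by (cases w) (auto dest: cons_reduce_reduced)

lemma reduced_foldr: "reduced v \<Longrightarrow> reduced (foldr cons_reduce u v)"
  by (induction u) (auto intro: reduced_cons_reduce)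

lemma set_cons_reduce: "set (cons_reduce a w) \<subseteq> insert a (set w)"
  by (cases "(a, w)" rule: cons_reduce.cases) auto

lemma set_foldr_cons_reduce: "set (foldr cons_reduce u v) \<subseteq> set u \<union> set v"
proof (induction u)
  case (Cons a u)
  then show ?case using set_cons_reduce[of a "foldr cons_reduce u v"] by auto
qed simp

text \<open>This is the action property of a single letter; associativity follows from it by induction.
  The only interesting case is that the letter cancels against the first letter of \<open>v\<close>.\<close>

lemma foldr_cons_reduce:
  assumes "reduced v" "reduced w"
  shows "foldr cons_reduce (cons_reduce a v) w = cons_reduce a (foldr cons_reduce v w)"
proof -
  obtain x b where a: "a = (x, b)" by force
  show ?thesis
  proof (cases "\<exists>v'. v = (x, \<not> b) # v'")
    case True
    then obtain v' where v: "v = (x, \<not> b) # v'" by blast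
    have "reduced (foldr cons_reduce v' w)" using assms reduced_foldr by blast
    then show ?thesis by (simp add: a v cons_reduce_cancel)
  next
    case False
    have "cons_reduce a v = a # v"
    proof (cases v)
      case (Cons c v')
      obtain y d where c: "c = (y, d)" by force
      have "\<not> (x = y \<and> b \<noteq> d)" using False unfolding Cons c by blast
      then show ?thesis unfolding Cons c a by simp
    qed (simp add: a)
    then show ?thesis by simp
  qed
qed

lemma foldr_cons_reduce_assoc:
  assumes "reduced v" "reduced w"
  shows "foldr cons_reduce (foldr cons_reduce u v) w = foldr cons_reduce u (foldr cons_reduce v w)"
  using assms by (induction u) (auto simp: foldr_cons_reduce reduced_foldr)

lemma group_free_group: "group (free_group X)"
proof (rule groupI)
  fix u assume "u \<in> carrier (free_group X)"
  then have "reduced u" "set u \<subseteq> X \<times> UNIV" by (auto simp: free_group_def)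
  then have "\<exists>v. reduced v \<and> set v \<subseteq> X \<times> UNIV \<and> foldr cons_reduce v u = []"
  proof (induction u)
    case Nil
    then show ?case by (intro exI[of _ "[]"]) auto
  next
    case (Cons a u)
    obtain x b where a: "a = (x, b)" by force
    obtain v where v: "reduced v" "set v \<subseteq> X \<times> UNIV" "foldr cons_reduce v u = []"
      using Cons.IH reduced_tl[OF Cons.prems(1)] Cons.prems(2) by auto
    let ?v = "foldr cons_reduce v [(x, \<not> b)]"
    have "foldr cons_reduce ?v (a # u) = foldr cons_reduce v (cons_reduce (x, \<not> b) (a # u))"
      using Cons.prems by (subst foldr_cons_reduce_assoc) auto
    also have "\<dots> = []" using v by (simp add: a)
    finally have "foldr cons_reduce ?v (a # u) = []" .
    moreover have "reduced ?v" by (rule reduced_foldr) simp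
    moreover have "set ?v \<subseteq> X \<times> UNIV"
      using set_foldr_cons_reduce[of v "[(x, \<not> b)]"] v(2) Cons.prems(2) by (auto simp: a)
    ultimately show ?case by blast
  qed
  then show "\<exists>v\<in>carrier (free_group X). v \<otimes>\<^bsub>free_group X\<^esub> u = \<one>\<^bsub>free_group X\<^esub>"
    by (auto simp: free_group_def)
next
  fix u v assume "u \<in> carrier (free_group X)" "v \<in> carrier (free_group X)"
  then show "u \<otimes>\<^bsub>free_group X\<^esub> v \<in> carrier (free_group X)"
    using set_foldr_cons_reduce[of u v] by (auto simp: free_group_def reduced_foldr)
qed (auto simp: free_group_def foldr_cons_reduce_assoc)

section \<open>The pro-\<open>p\<close> completion and its topology\<close>

locale pro_p = group F for F (structure) +
  fixes p :: nat
  assumes prime_p: "prime p"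
begin

abbreviation "I \<equiv> p_index_normals p F"
abbreviation "Fh \<equiv> pro_p_completion p F"
abbreviation "T \<equiv> pro_p_topology p F"

lemma normal_I: "M \<in> I \<Longrightarrow> M \<lhd> F"
  by (simp add: p_index_normals_def)

lemma finite_I: "M \<in> I \<Longrightarrow> finite (carrier (F Mod M))"
  using prime_gt_0_nat[OF prime_p] card_ge_0_finite[of "rcosets M"]
  by (auto simp: p_index_normals_def FactGroup_def)

lemma carrier_in_I: "carrier F \<in> I"
proof -
  have "rcosets (carrier F) = {carrier F}"
    using coset_join2[OF _ subgroup_self] by (auto simp: RCOSETS_def)
  then have "card (rcosets (carrier F)) = p ^ 0" by simp
  then show ?thesis unfolding p_index_normals_def using normal_self by blast
qed

text \<open>\<open>F/(M \<inter> M')\<close> embeds into \<open>F/M \<times> F/M'\<close>, so its order divides a power of \<open>p\<close>. Together with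
  \<open>carrier_in_I\<close> this makes the levels a directed set: one level refines any finite number of them.\<close>

lemma Int_in_I:
  assumes "M \<in> I" "M' \<in> I"
  shows "M \<inter> M' \<in> I"
proof -
  interpret M: normal M F using assms normal_I by blast
  interpret M': normal M' F using assms normal_I by blast
  interpret MM: normal "M \<inter> M'" F
    using normal_subgroup_intersect M.normal_axioms M'.normal_axioms by blast
  interpret Q: group "F Mod M" by (rule M.factorgroup_is_group)
  interpret Q': group "F Mod M'" by (rule M'.factorgroup_is_group)
  interpret P: group "(F Mod M) \<times>\<times> (F Mod M')"
    using DirProd_group Q.is_group Q'.is_group by blast
  let ?\<phi> = "\<lambda>g. (M #> g, M' #> g)"
  interpret h: group_hom F "(F Mod M) \<times>\<times> (F Mod M')" ?\<phi>
    by unfold_locales (auto simp: hom_def carrier_FactGroup M.rcos_sum M'.rcos_sum)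
  have ker: "kernel F ((F Mod M) \<times>\<times> (F Mod M')) ?\<phi> = M \<inter> M'"
    using coset_join1[OF _ _ M.is_subgroup] coset_join1[OF _ _ M'.is_subgroup]
      M.rcos_const[OF is_group] M'.rcos_const[OF is_group] M.subset
    by (auto simp: kernel_def DirProd_def)
  let ?J = "((F Mod M) \<times>\<times> (F Mod M'))\<lparr>carrier := ?\<phi> ` carrier F\<rparr>"
  have sub: "subgroup (?\<phi> ` carrier F) ((F Mod M) \<times>\<times> (F Mod M'))"
    by (rule h.img_is_subgroup)
  have "group_hom F ?J ?\<phi>"
    using h.homh by (intro group_hom.intro group_hom_axioms.intro is_group P.subgroup_imp_group[OF sub])
      (auto simp: hom_def)
  then have "(\<lambda>X. the_elem (?\<phi> ` X)) \<in> iso (F Mod kernel F ?J ?\<phi>) ?J"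
    by (rule group_hom.FactGroup_iso_set) simp
  then have "bij_betw (\<lambda>X. the_elem (?\<phi> ` X)) (rcosets (M \<inter> M')) (?\<phi> ` carrier F)"
    using ker by (simp add: iso_def kernel_def FactGroup_def)
  then have card: "card (rcosets (M \<inter> M')) = card (?\<phi> ` carrier F)"
    by (rule bij_betw_same_card)
  obtain k k' where k: "card (rcosets M) = p ^ k" "card (rcosets M') = p ^ k'"
    using assms by (auto simp: p_index_normals_def)
  have "card (?\<phi> ` carrier F) dvd order ((F Mod M) \<times>\<times> (F Mod M'))"
    unfolding P.lagrange[OF sub, symmetric] by (rule dvd_triv_right)
  also have "order ((F Mod M) \<times>\<times> (F Mod M')) = p ^ (k + k')"
    using k by (simp add: order_def DirProd_def FactGroup_def power_add card_cartesian_product)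
  finally obtain j where "card (rcosets (M \<inter> M')) = p ^ j"
    unfolding card[symmetric] using divides_primepow_nat[OF prime_p] by blast
  then show ?thesis using MM.normal_axioms by (auto simp: p_index_normals_def)
qed

lemma finite_subset_I_lower_bound:
  assumes "finite \<M>" "\<M> \<subseteq> I"
  shows "\<exists>M\<in>I. \<forall>M'\<in>\<M>. M \<subseteq> M'"
  using assms
proof (induction \<M>)
  case empty
  then show ?case using carrier_in_I by blast
next
  case (insert M' \<M>)
  then obtain M where "M \<in> I" "\<forall>M'\<in>\<M>. M \<subseteq> M'" by auto
  then show ?case using Int_in_I insert.prems by (intro bexI[of _ "M \<inter> M'"]) auto
qed

lemma comp_in_quotient: "g \<in> carrier Fh \<Longrightarrow> M \<in> I \<Longrightarrow> g M \<in> carrier (F Mod M)"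
  by (auto simp: pro_p_completion_def)

lemma coset_mono_eq:
  assumes M: "M \<in> I" "M' \<in> I" "M \<subseteq> M'" and c: "c \<in> carrier (F Mod M)"
    and d: "d \<in> carrier (F Mod M')" "d' \<in> carrier (F Mod M')" "c \<subseteq> d" "c \<subseteq> d'"
  shows "d = d'"
proof -
  interpret M: normal M F using M normal_I by blast
  interpret M': normal M' F using M normal_I by blast
  have "c \<noteq> {}" using c M.rcosets_non_empty by (simp add: FactGroup_def)
  then have "d \<inter> d' \<noteq> {}" using d by blast
  then show ?thesis
    using rcos_disjoint[OF M'.is_subgroup] d by (auto simp: FactGroup_def pairwise_def disjnt_def)
qed

lemma Fh_mono: "g \<in> carrier Fh \<Longrightarrow> M \<in> I \<Longrightarrow> M' \<in> I \<Longrightarrow> M \<subseteq> M' \<Longrightarrow> g M \<subseteq> g M'"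
  by (auto simp: pro_p_completion_def)

lemma comp_eq_mono:
  assumes "g \<in> carrier Fh" "h \<in> carrier Fh" "M \<in> I" "M' \<in> I" "M \<subseteq> M'" "g M = h M"
  shows "g M' = h M'"
proof (rule coset_mono_eq[OF assms(3-5)])
  show "g M \<subseteq> g M'" using Fh_mono assms by blast
  show "g M \<subseteq> h M'" using Fh_mono[of h M M'] assms by simp
qed (use assms comp_in_quotient in auto)

lemma mult_comp [simp]: "M \<in> I \<Longrightarrow> (g \<otimes>\<^bsub>Fh\<^esub> h) M = g M <#> h M"
  by (simp add: pro_p_completion_def)

lemma one_comp [simp]: "M \<in> I \<Longrightarrow> \<one>\<^bsub>Fh\<^esub> M = M"
  by (simp add: pro_p_completion_def)

lemma carrier_FhI:
  assumes "\<And>M. M \<in> I \<Longrightarrow> g M \<in> carrier (F Mod M)"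
    and "\<And>M M'. M \<in> I \<Longrightarrow> M' \<in> I \<Longrightarrow> M \<subseteq> M' \<Longrightarrow> g M \<subseteq> g M'"
    and "g \<in> extensional I"
  shows "g \<in> carrier Fh"
  using assms by (auto simp: pro_p_completion_def PiE_def)

lemma Fh_extensional: "g \<in> carrier Fh \<Longrightarrow> g \<in> extensional I"
  by (auto simp: pro_p_completion_def PiE_def)

lemma Fh_eqI:
  assumes "g \<in> carrier Fh" "h \<in> carrier Fh" "\<And>M. M \<in> I \<Longrightarrow> g M = h M"
  shows "g = h"
  using assms Fh_extensional extensionalityI by blast

lemma group_quotient: "M \<in> I \<Longrightarrow> group (F Mod M)"
  using normal_I normal.factorgroup_is_group by blast

lemma mult_Fh_closed:
  assumes "g \<in> carrier Fh" "h \<in> carrier Fh"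
  shows "g \<otimes>\<^bsub>Fh\<^esub> h \<in> carrier Fh"
proof (rule carrier_FhI)
  show "(g \<otimes>\<^bsub>Fh\<^esub> h) M \<in> carrier (F Mod M)" if "M \<in> I" for M
    using monoid.m_closed[OF group.is_monoid[OF group_quotient[OF that]]] comp_in_quotient assms that
    by simp
  show "(g \<otimes>\<^bsub>Fh\<^esub> h) M \<subseteq> (g \<otimes>\<^bsub>Fh\<^esub> h) M'" if "M \<in> I" "M' \<in> I" "M \<subseteq> M'" for M M'
    using that by (simp add: mono_set_mult Fh_mono[OF assms(1)] Fh_mono[OF assms(2)])
qed (simp add: pro_p_completion_def)

lemma one_Fh_closed: "\<one>\<^bsub>Fh\<^esub> \<in> carrier Fh"
proof (rule carrier_FhI)
  show "\<one>\<^bsub>Fh\<^esub> M \<in> carrier (F Mod M)" if "M \<in> I" for M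
    using monoid.one_closed[OF group.is_monoid[OF group_quotient[OF that]]] that by simp
qed (simp_all add: pro_p_completion_def)

lemma group_Fh: "group Fh"
proof (rule groupI)
  fix g assume g: "g \<in> carrier Fh"
  define h where "h = (\<lambda>M\<in>I. inv\<^bsub>F Mod M\<^esub> (g M))"
  have h: "h M = set_inv (g M)" if "M \<in> I" for M
    using normal.inv_FactGroup[OF normal_I[OF that]] comp_in_quotient[OF g that] that
    by (simp add: h_def)
  have "h \<in> carrier Fh"
  proof (rule carrier_FhI)
    show "h M \<in> carrier (F Mod M)" if "M \<in> I" for M
      using group.inv_closed[OF group_quotient[OF that] comp_in_quotient[OF g that]] that
      by (simp add: h_def)
    show "h M \<subseteq> h M'" if "M \<in> I" "M' \<in> I" "M \<subseteq> M'" for M M'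
      using Fh_mono[OF g that] that unfolding h[OF that(1)] h[OF that(2)] SET_INV_def by blast
  qed (simp add: h_def)
  moreover have "h \<otimes>\<^bsub>Fh\<^esub> g = \<one>\<^bsub>Fh\<^esub>"
  proof (rule Fh_eqI)
    show "(h \<otimes>\<^bsub>Fh\<^esub> g) M = \<one>\<^bsub>Fh\<^esub> M" if "M \<in> I" for M
      using group.l_inv[OF group_quotient[OF that] comp_in_quotient[OF g that]] that
      by (simp add: h_def)
  qed (use g \<open>h \<in> carrier Fh\<close> mult_Fh_closed one_Fh_closed in auto)
  ultimately show "\<exists>h\<in>carrier Fh. h \<otimes>\<^bsub>Fh\<^esub> g = \<one>\<^bsub>Fh\<^esub>" by blast
next
  fix f g h assume fgh: "f \<in> carrier Fh" "g \<in> carrier Fh" "h \<in> carrier Fh"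
  show "f \<otimes>\<^bsub>Fh\<^esub> g \<otimes>\<^bsub>Fh\<^esub> h = f \<otimes>\<^bsub>Fh\<^esub> (g \<otimes>\<^bsub>Fh\<^esub> h)"
  proof (rule Fh_eqI)
    show "(f \<otimes>\<^bsub>Fh\<^esub> g \<otimes>\<^bsub>Fh\<^esub> h) M = (f \<otimes>\<^bsub>Fh\<^esub> (g \<otimes>\<^bsub>Fh\<^esub> h)) M" if "M \<in> I" for M
      using monoid.m_assoc[OF group.is_monoid[OF group_quotient[OF that]]] fgh comp_in_quotient that
      by simp
  qed (use fgh mult_Fh_closed in auto)
next
  fix g assume g: "g \<in> carrier Fh"
  show "\<one>\<^bsub>Fh\<^esub> \<otimes>\<^bsub>Fh\<^esub> g = g"
  proof (rule Fh_eqI)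
    show "(\<one>\<^bsub>Fh\<^esub> \<otimes>\<^bsub>Fh\<^esub> g) M = g M" if "M \<in> I" for M
      using monoid.l_one[OF group.is_monoid[OF group_quotient[OF that]]] g comp_in_quotient that
      by simp
  qed (use g one_Fh_closed mult_Fh_closed in auto)
qed (use mult_Fh_closed one_Fh_closed in auto)

sublocale Fh: group Fh by (rule group_Fh)

lemma comp_group_hom: "M \<in> I \<Longrightarrow> group_hom Fh (F Mod M) (\<lambda>g. g M)"
  by (intro group_hom.intro group_hom_axioms.intro group_Fh group_quotient)
    (auto simp: hom_def comp_in_quotient)

text \<open>The kernels of the projections to the levels; they form a basis of neighbourhoods of \<open>1\<close>.\<close>

definition U :: "'a set \<Rightarrow> ('a set \<Rightarrow> 'a set) set" where
  "U M = {g \<in> carrier Fh. g M = M}"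

lemma U_normal: "M \<in> I \<Longrightarrow> U M \<lhd> Fh"
  using group_hom.normal_kernel[OF comp_group_hom] by (simp add: U_def kernel_def)

lemma inv_mult_in_U:
  assumes "g \<in> carrier Fh" "h \<in> carrier Fh" "M \<in> I"
  shows "inv\<^bsub>Fh\<^esub> g \<otimes>\<^bsub>Fh\<^esub> h \<in> U M \<longleftrightarrow> g M = h M"
proof -
  interpret h: group_hom Fh "F Mod M" "\<lambda>g. g M" by (rule comp_group_hom[OF assms(3)])
  have "inv\<^bsub>Fh\<^esub> g \<otimes>\<^bsub>Fh\<^esub> h \<in> U M \<longleftrightarrow> inv\<^bsub>F Mod M\<^esub> (g M) \<otimes>\<^bsub>F Mod M\<^esub> h M = \<one>\<^bsub>F Mod M\<^esub>"
    using assms h.hom_inv[of g] by (simp add: U_def)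
  also have "\<dots> \<longleftrightarrow> g M = h M"
    using assms comp_in_quotient h.H.inv_comm h.H.inv_equality h.H.inv_inv h.H.l_inv
    by (metis h.H.inv_closed)
  finally show ?thesis .
qed

lemma pow_in_U:
  assumes "M \<in> I" obtains k where "\<And>g. g \<in> carrier Fh \<Longrightarrow> g [^]\<^bsub>Fh\<^esub> (p ^ k) \<in> U M"
proof -
  interpret h: group_hom Fh "F Mod M" "\<lambda>g. g M" by (rule comp_group_hom[OF assms])
  obtain k where k: "card (rcosets M) = p ^ k" using assms by (auto simp: p_index_normals_def)
  show thesis
  proof (rule that)
    fix g assume g: "g \<in> carrier Fh"
    have "g M [^]\<^bsub>F Mod M\<^esub> order (F Mod M) = \<one>\<^bsub>F Mod M\<^esub>"
      using h.H.pow_order_eq_1 comp_in_quotient g assms by blast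
    moreover have "order (F Mod M) = p ^ k" using k by (simp add: order_def FactGroup_def)
    ultimately show "g [^]\<^bsub>Fh\<^esub> (p ^ k) \<in> U M"
      using h.hom_nat_pow[OF g, of "p ^ k"] g by (simp add: U_def)
  qed
qed

lemma to_pro_p_comp [simp]: "M \<in> I \<Longrightarrow> to_pro_p p F w M = M #> w"
  by (simp add: to_pro_p_def)

lemma to_pro_p_hom: "group_hom F Fh (to_pro_p p F)"
proof (intro group_hom.intro group_hom_axioms.intro group_Fh is_group homI)
  fix w assume w: "w \<in> carrier F"
  show "to_pro_p p F w \<in> carrier Fh"
  proof (rule carrier_FhI)
    show "to_pro_p p F w M \<in> carrier (F Mod M)" if "M \<in> I" for M
      using w that by (auto simp: carrier_FactGroup)
  qed (auto simp: r_coset_def to_pro_p_def)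
next
  fix v w assume vw: "v \<in> carrier F" "w \<in> carrier F"
  have "M #> (v \<otimes> w) = (M #> v) <#> (M #> w)" if "M \<in> I" for M
    using normal.rcos_sum[OF normal_I[OF that]] vw by simp
  then show "to_pro_p p F (v \<otimes> w) = to_pro_p p F v \<otimes>\<^bsub>Fh\<^esub> to_pro_p p F w"
    by (auto simp: to_pro_p_def pro_p_completion_def fun_eq_iff)
qed

lemma to_pro_p_dense:
  assumes "g \<in> carrier Fh" "M \<in> I"
  shows "\<exists>w\<in>carrier F. to_pro_p p F w M = g M"
  using comp_in_quotient[OF assms] assms by (auto simp: carrier_FactGroup)

lemma topspace_T [simp]: "topspace T = carrier Fh"
  by (auto simp: pro_p_topology_def pro_p_completion_def)

lemma continuous_comp:
  assumes "M \<in> I" shows "continuous_map T (discrete_topology (carrier (F Mod M))) (\<lambda>g. g M)"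
  unfolding pro_p_topology_def
  using assms by (intro continuous_map_from_subtopology continuous_map_product_coordinates)

text \<open>A basic open set of the product restricts finitely many components; by directedness and
  coherence, fixing one component at a finer level suffices.\<close>

lemma openin_T:
  "openin T S \<longleftrightarrow> S \<subseteq> carrier Fh \<and>
    (\<forall>g\<in>S. \<exists>M\<in>I. \<forall>h\<in>carrier Fh. h M = g M \<longrightarrow> h \<in> S)"
proof
  assume S: "openin T S"
  have "\<exists>M\<in>I. \<forall>h\<in>carrier Fh. h M = g M \<longrightarrow> h \<in> S" if g: "g \<in> S" for g
  proof -
    obtain S' where S': "S = S' \<inter> carrier Fh"
      and op: "openin (product_topology (\<lambda>M. discrete_topology (carrier (F Mod M))) I) S'"
      using S unfolding pro_p_topology_def openin_subtopology by blast
    then obtain V where V: "finite {M \<in> I. V M \<noteq> carrier (F Mod M)}" "g \<in> Pi\<^sub>E I V" "Pi\<^sub>E I V \<subseteq> S'"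
      using g unfolding openin_product_topology_alt by (auto dest!: bspec[of _ _ g])
    obtain M where M: "M \<in> I" "\<forall>M'\<in>{M \<in> I. V M \<noteq> carrier (F Mod M)}. M \<subseteq> M'"
      using finite_subset_I_lower_bound[OF V(1)] by auto
    have gF: "g \<in> carrier Fh" using g S' by blast
    have "h \<in> S" if h: "h \<in> carrier Fh" "h M = g M" for h
    proof -
      have "h M' \<in> V M'" if M': "M' \<in> I" for M'
      proof (cases "V M' = carrier (F Mod M')")
        case True
        then show ?thesis using comp_in_quotient[OF h(1) M'] by simp
      next
        case False
        then have "M \<subseteq> M'" using M M' by blast
        then have "h M' = g M'" using comp_eq_mono[OF h(1) gF M(1) M'] h(2) by blast
        then show ?thesis using V(2) M' by auto
      qed
      then have "h \<in> Pi\<^sub>E I V" using Fh_extensional[OF h(1)] by (auto simp: PiE_def)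
      then show ?thesis using V(3) S' h(1) by blast
    qed
    then show ?thesis using M(1) by blast
  qed
  then show "S \<subseteq> carrier Fh \<and> (\<forall>g\<in>S. \<exists>M\<in>I. \<forall>h\<in>carrier Fh. h M = g M \<longrightarrow> h \<in> S)"
    using openin_subset[OF S] by simp
next
  assume S: "S \<subseteq> carrier Fh \<and> (\<forall>g\<in>S. \<exists>M\<in>I. \<forall>h\<in>carrier Fh. h M = g M \<longrightarrow> h \<in> S)"
  show "openin T S"
  proof (subst openin_subopen, intro ballI)
    fix g assume g: "g \<in> S"
    obtain M where M: "M \<in> I" "\<forall>h\<in>carrier Fh. h M = g M \<longrightarrow> h \<in> S" using S g by blast
    have "g M \<in> carrier (F Mod M)" using S g M comp_in_quotient by blast
    then have "openin T {h \<in> topspace T. h M \<in> {g M}}"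
      by (intro openin_continuous_map_preimage[OF continuous_comp[OF M(1)]]) simp
    then show "\<exists>O'. openin T O' \<and> g \<in> O' \<and> O' \<subseteq> S"
      by (intro exI[of _ "{h \<in> topspace T. h M \<in> {g M}}"] conjI) (use M S g in auto)
  qed
qed

lemma openin_compI:
  assumes "M \<in> I" "\<And>g h. g \<in> S \<Longrightarrow> h \<in> carrier Fh \<Longrightarrow> h M = g M \<Longrightarrow> h \<in> S" "S \<subseteq> carrier Fh"
  shows "openin T S"
  using assms unfolding openin_T by blast

lemma in_closure_T:
  assumes "g \<in> carrier Fh" "\<And>M. M \<in> I \<Longrightarrow> \<exists>s\<in>S. s \<in> carrier Fh \<and> s M = g M"
  shows "g \<in> T closure_of S"
proof -
  have "\<exists>s\<in>S. s \<in> O'" if "g \<in> O'" "openin T O'" for O'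
    using that assms unfolding openin_T by meson
  then show ?thesis using assms(1) unfolding in_closure_of topspace_T by blast
qed

lemma in_closedin_T:
  assumes "closedin T S" "g \<in> carrier Fh" "\<And>M. M \<in> I \<Longrightarrow> \<exists>s\<in>S. s M = g M"
  shows "g \<in> S"
proof -
  have "S \<subseteq> carrier Fh" using closedin_subset[OF assms(1)] by simp
  then have "g \<in> T closure_of S" using assms by (intro in_closure_T) (auto simp: subset_iff)
  then show ?thesis using assms(1) by (simp add: closure_of_closedin)
qed

text \<open>The coherence condition for a pair of levels is closed, because it involves only two components
  with finitely many values each. So the completion is closed in a product of finite spaces.\<close>

lemma compact_T: "compact_space T"
proof -
  let ?P = "product_topology (\<lambda>M. discrete_topology (carrier (F Mod M))) I"
  have cont: "continuous_map ?P (discrete_topology (carrier (F Mod M))) (\<lambda>g. g M)" if "M \<in> I" for M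
    using that by (rule continuous_map_product_coordinates)
  have "closedin ?P (carrier Fh)"
  proof -
    have pre: "closedin ?P {g \<in> topspace ?P. g M \<in> A}" if "M \<in> I" "A \<subseteq> carrier (F Mod M)" for M A
      using that by (intro closedin_continuous_map_preimage[OF cont])
        (auto simp: closedin_def)
    have "closedin ?P {g \<in> topspace ?P. g M \<subseteq> g M'}" if M: "M \<in> I" "M' \<in> I" for M M'
    proof -
      have cl: "closedin ?P ({g \<in> topspace ?P. g M \<in> {c}} \<inter>
             {g \<in> topspace ?P. g M' \<in> {d \<in> carrier (F Mod M'). c \<subseteq> d}})"
        if "c \<in> carrier (F Mod M)" for c
        using that by (intro closedin_Int pre M) simp_all
      have "{g \<in> topspace ?P. g M \<subseteq> g M'} =
          (\<Union>c\<in>carrier (F Mod M). {g \<in> topspace ?P. g M \<in> {c}} \<inter>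
             {g \<in> topspace ?P. g M' \<in> {d \<in> carrier (F Mod M'). c \<subseteq> d}})"
        using M by (auto simp: PiE_iff)
      also have "closedin ?P \<dots>"
        by (intro closedin_Union finite_imageI finite_I[OF M(1)]) (use cl in blast)
      finally show ?thesis .
    qed
    then have "closedin ?P (\<Inter>(M, M')\<in>{(M, M') \<in> I \<times> I. M \<subseteq> M'}. {g \<in> topspace ?P. g M \<subseteq> g M'})"
      using carrier_in_I by (intro closedin_Inter) auto
    also have "\<dots> = carrier Fh"
      using carrier_in_I by (auto simp: pro_p_completion_def)
    finally show ?thesis .
  qed
  moreover have "compact_space ?P"
    using finite_I by (auto simp: compact_space_product_topology compact_space_discrete_topology)
  ultimately show ?thesis
    unfolding pro_p_topology_def by (intro compact_space_subtopology closedin_compact_space)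
qed

end

section \<open>Approximation at a finite level\<close>

lemma (in group) subgroup_nat_pow_closed:
  assumes "subgroup H G" "a \<in> H"
  shows "a [^] (n::nat) \<in> H"
  by (induction n) (use assms in \<open>auto simp: subgroup.one_closed subgroup.m_closed\<close>)

lemma (in group) normal_closure_normal:
  assumes "A \<subseteq> carrier G"
  shows "normal_closure G A \<lhd> G"
proof -
  let ?S = "{M. M \<lhd> G \<and> A \<subseteq> M}"
  have ne: "?S \<noteq> {}" using assms normal_self by blast
  have "subgroup (\<Inter>?S) G"
    by (rule subgroups_Inter) (use ne normal_imp_subgroup in auto)
  then have "\<Inter>?S \<lhd> G"
    by (rule normal_invI) (auto intro: normal.inv_op_closed2)
  then show ?thesis by (simp add: normal_closure_def hull_def)
qed

context pro_p
begin

lemma closedin_comp: "M \<in> I \<Longrightarrow> closedin T {g \<in> carrier Fh. g M \<in> A}"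
  unfolding closedin_def by (auto intro: openin_compI)

text \<open>In general \<open>H \<inter> N U M'\<close> has elements that are not congruent modulo \<open>U M\<close> to an element of \<open>H \<inter> N\<close>,
  but these exceptional elements form closed sets \<open>Z M'\<close> that decrease with \<open>M'\<close>. If none of them was
  empty, they would have a common element; as \<open>N\<close> is closed, it would belong to \<open>N\<close>.\<close>

lemma compact_intersection:
  assumes H: "closedin T H" and N: "closedin T N" and M: "M \<in> I"
  shows "\<exists>M'\<in>I. M' \<subseteq> M \<and> (\<forall>a\<in>H. \<forall>b\<in>N. a M' = b M' \<longrightarrow> (\<exists>c\<in>H \<inter> N. c M = a M))"
proof (rule ccontr)
  define Q where "Q M' \<longleftrightarrow> (\<forall>a\<in>H. \<forall>b\<in>N. a M' = b M' \<longrightarrow> (\<exists>c\<in>H \<inter> N. c M = a M))" for M'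
  assume "\<not> ?thesis"
  then have contra: "\<not> (\<exists>M'\<in>I. M' \<subseteq> M \<and> Q M')" by (simp only: Q_def not_False_eq_True simp_thms)
  have sub: "H \<subseteq> carrier Fh" "N \<subseteq> carrier Fh"
    using closedin_subset[OF H] closedin_subset[OF N] by simp_all
  define Z where "Z M' = H \<inter> {g \<in> carrier Fh. g M' \<in> (\<lambda>b. b M') ` N}
      \<inter> {g \<in> carrier Fh. g M \<in> - (\<lambda>c. c M) ` (H \<inter> N)}" for M'
  let ?I = "{M' \<in> I. M' \<subseteq> M}"
  have closed_Z: "closedin T (Z M')" if "M' \<in> ?I" for M'
    unfolding Z_def using that H M by (intro closedin_Int closedin_comp) auto
  have inter_Z: "\<Inter>\<F> \<noteq> {}" if \<F>: "finite \<F>" "\<F> \<subseteq> Z ` ?I" for \<F>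
  proof -
    obtain \<M> where \<M>: "\<M> \<subseteq> ?I" "finite \<M>" "\<F> = Z ` \<M>"
      using \<F> by (meson finite_subset_image)
    have "finite (insert M \<M>)" "insert M \<M> \<subseteq> I" using \<M> M by auto
    from finite_subset_I_lower_bound[OF this]
    obtain M' where M': "M' \<in> I" "M' \<subseteq> M" "\<forall>M1\<in>\<M>. M' \<subseteq> M1" by auto
    have "\<not> Q M'" using contra M' by blast
    then obtain a b where ab: "a \<in> H" "b \<in> N" "a M' = b M'" "\<not> (\<exists>c\<in>H \<inter> N. c M = a M)"
      unfolding Q_def by meson
    have "a \<in> Z M1" if "M1 \<in> \<M>" for M1
    proof -
      have "a M1 = b M1"
        using comp_eq_mono[of a b M' M1] ab sub M' that \<M> by blast
      then show ?thesis using ab sub unfolding Z_def by blast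
    qed
    then show ?thesis using \<M>(3) by blast
  qed
  have "\<Inter>(Z ` ?I) \<noteq> {}"
  proof (rule compact_T[unfolded compact_space_fip, rule_format], intro conjI ballI allI impI)
    fix C assume "C \<in> Z ` ?I"
    then show "closedin T C" by (elim imageE) (simp only: closed_Z)
  next
    fix \<F> assume "finite \<F> \<and> \<F> \<subseteq> Z ` ?I"
    then show "\<Inter>\<F> \<noteq> {}" by (intro inter_Z) (simp_all only: simp_thms)
  qed
  then obtain a where a: "\<And>M'. M' \<in> I \<Longrightarrow> M' \<subseteq> M \<Longrightarrow> a \<in> Z M'" by blast
  from a[OF M order_refl] have aH: "a \<in> H" "a \<in> carrier Fh" unfolding Z_def by simp_all
  have "a \<in> N"
  proof (rule in_closedin_T[OF N aH(2)])
    fix M1 assume M1: "M1 \<in> I"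
    then have "M1 \<inter> M \<in> I" using M Int_in_I by blast
    moreover from this have "a \<in> Z (M1 \<inter> M)" using a by blast
    then obtain b where "b \<in> N" "b (M1 \<inter> M) = a (M1 \<inter> M)" unfolding Z_def by force
    ultimately show "\<exists>s\<in>N. s M1 = a M1"
      using comp_eq_mono[of _ a "M1 \<inter> M" M1] sub(2) aH(2) M1 by blast
  qed
  then show False using aH a[OF M] unfolding Z_def by blast
qed

lemma normal_mult_U:
  assumes "N \<lhd> Fh" "M \<in> I"
  shows "N <#>\<^bsub>Fh\<^esub> U M = {a \<in> carrier Fh. \<exists>b\<in>N. a M = b M}"
proof -
  interpret N: normal N Fh by fact
  interpret U: normal "U M" Fh using U_normal assms by blast
  show ?thesis
  proof (intro equalityI subsetI)
    fix a assume "a \<in> N <#>\<^bsub>Fh\<^esub> U M"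
    then obtain b u where bu: "b \<in> N" "u \<in> U M" "a = b \<otimes>\<^bsub>Fh\<^esub> u" by (auto simp: set_mult_def)
    then have "inv\<^bsub>Fh\<^esub> b \<otimes>\<^bsub>Fh\<^esub> a = u" using Fh.inv_cancel by simp
    then have "b M = a M" using bu inv_mult_in_U[of b a M] assms(2) by simp
    then show "a \<in> {a \<in> carrier Fh. \<exists>b\<in>N. a M = b M}" using bu by auto
  next
    fix a assume "a \<in> {a \<in> carrier Fh. \<exists>b\<in>N. a M = b M}"
    then obtain b where b: "a \<in> carrier Fh" "b \<in> N" "b M = a M" by auto
    then have "inv\<^bsub>Fh\<^esub> b \<otimes>\<^bsub>Fh\<^esub> a \<in> U M" using inv_mult_in_U assms by simp
    from mem_set_mult[OF b(2) this, of Fh] show "a \<in> N <#>\<^bsub>Fh\<^esub> U M"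
      using b Fh.inv_cancel by simp
  qed
qed

lemma finite_index_mult_U:
  assumes "N \<lhd> Fh" "M \<in> I"
  shows "finite (carrier (Fh Mod (N <#>\<^bsub>Fh\<^esub> U M)))"
proof -
  let ?L = "N <#>\<^bsub>Fh\<^esub> U M"
  have L: "?L \<lhd> Fh" using Fh.normal_subgroup_set_mult_closed assms U_normal by blast
  interpret L: normal ?L Fh by (rule L)
  have eq: "?L #>\<^bsub>Fh\<^esub> g = ?L #>\<^bsub>Fh\<^esub> h" if "g \<in> carrier Fh" "h \<in> carrier Fh" "g M = h M" for g h
  proof -
    interpret h: group_hom Fh "F Mod M" "\<lambda>g. g M" by (rule comp_group_hom[OF assms(2)])
    have "(g \<otimes>\<^bsub>Fh\<^esub> inv\<^bsub>Fh\<^esub> h) M = \<one>\<^bsub>Fh\<^esub> M"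
      using that h.hom_mult[of g "inv\<^bsub>Fh\<^esub> h"] h.hom_mult[of h "inv\<^bsub>Fh\<^esub> h"] assms(2) by simp
    moreover have "\<one>\<^bsub>Fh\<^esub> \<in> N" using assms(1) normal_imp_subgroup subgroup.one_closed by blast
    ultimately have "g \<otimes>\<^bsub>Fh\<^esub> inv\<^bsub>Fh\<^esub> h \<in> ?L"
      unfolding normal_mult_U[OF assms] using that by blast
    then have "g \<in> ?L #>\<^bsub>Fh\<^esub> h" using L.rcos_module_rev[OF group_Fh] that by simp
    then show ?thesis using Fh.repr_independence[OF _ that(2) L.is_subgroup] by simp
  qed
  have "carrier (Fh Mod ?L) \<subseteq> (\<lambda>c. ?L #>\<^bsub>Fh\<^esub> (SOME g. g \<in> carrier Fh \<and> g M = c)) ` carrier (F Mod M)"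
  proof
    fix C assume "C \<in> carrier (Fh Mod ?L)"
    then obtain g where g: "g \<in> carrier Fh" "C = ?L #>\<^bsub>Fh\<^esub> g" by (auto simp: carrier_FactGroup)
    let ?h = "SOME h. h \<in> carrier Fh \<and> h M = g M"
    have "?h \<in> carrier Fh \<and> ?h M = g M" by (rule someI[of _ g]) (use g in simp)
    then have "C = ?L #>\<^bsub>Fh\<^esub> ?h" using eq[of g ?h] g by simp
    then show "C \<in> (\<lambda>c. ?L #>\<^bsub>Fh\<^esub> (SOME g. g \<in> carrier Fh \<and> g M = c)) ` carrier (F Mod M)"
      using comp_in_quotient[OF g(1) assms(2)] by blast
  qed
  then show ?thesis using finite_I[OF assms(2)] finite_surj by blast
qed

lemma open_mult_U:
  assumes "N \<lhd> Fh" "M \<in> I"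
  shows "openin T (N <#>\<^bsub>Fh\<^esub> U M)"
  by (rule openin_compI[OF assms(2)]) (auto simp: normal_mult_U[OF assms])

text \<open>The algebraic core at a finite level. The subgroup \<open>L = N U M'\<close> has to be defined at a finer
  level \<open>M'\<close> than \<open>M\<close> in order that \<open>H \<inter> L\<close> is contained in the product of \<open>H \<inter> N\<close> and \<open>U M\<close>. Since
  \<open>U M\<close> need not be contained in \<open>L\<close>, the core is applied to the intersection of \<open>L\<close> and \<open>B\<close>.\<close>

lemma word_near_product:
  assumes N: "N \<lhd> Fh" "closedin T N" and H: "subgroup H Fh" "closedin T H"
    and X: "finite X" "x \<in> X \<rightarrow> carrier Fh" and K: "K \<subseteq> X" "x ` K \<subseteq> H" and M: "M \<in> I"
  obtains M' m where "M' \<in> I" "M' \<subseteq> M"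
    "\<And>w. set w \<subseteq> X \<times> UNIV \<Longrightarrow>
      (\<And>k C. k \<in> X - K \<Longrightarrow> C \<in> carrier (Fh Mod (N <#>\<^bsub>Fh\<^esub> U M')) \<Longrightarrow>
        int (p ^ m) dvd fox_count (\<lambda>u. (N <#>\<^bsub>Fh\<^esub> U M') #>\<^bsub>Fh\<^esub> word_value Fh x u) k w C) \<Longrightarrow>
      \<exists>s\<in>(H <#>\<^bsub>Fh\<^esub> normal_closure Fh (H \<inter> N)) <#>\<^bsub>Fh\<^esub> derived Fh N.
        s \<in> carrier Fh \<and> s M = word_value Fh x w M"
proof -
  interpret N: normal N Fh by fact
  interpret H: subgroup H Fh by fact
  obtain M' where M': "M' \<in> I" "M' \<subseteq> M"
    and HN: "\<And>a b. a \<in> H \<Longrightarrow> b \<in> N \<Longrightarrow> a M' = b M' \<Longrightarrow> \<exists>c\<in>H \<inter> N. c M = a M"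
    using compact_intersection[OF H(2) N(2) M] by meson
  obtain k where k: "\<And>g. g \<in> carrier Fh \<Longrightarrow> g [^]\<^bsub>Fh\<^esub> (p ^ k) \<in> U M" 
    using pow_in_U[OF M] by metis
  let ?A = "normal_closure Fh (H \<inter> N)" and ?D = "derived Fh N" and ?L = "N <#>\<^bsub>Fh\<^esub> U M'"
  define B where "B = (?A <#>\<^bsub>Fh\<^esub> ?D) <#>\<^bsub>Fh\<^esub> U M"
  interpret A: normal ?A Fh by (rule Fh.normal_closure_normal) (use N.subset in blast)
  interpret D: normal ?D Fh by (rule Fh.derived_is_normal[OF N(1)])
  interpret UM: normal "U M" Fh by (rule U_normal[OF M])
  interpret L: normal ?L Fh
    using Fh.normal_subgroup_set_mult_closed N(1) U_normal[OF M'(1)] by blast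
  interpret B: normal B Fh
    unfolding B_def
    by (intro Fh.normal_subgroup_set_mult_closed A.normal_axioms D.normal_axioms UM.normal_axioms)
  have inA: "c \<in> ?A" if "c \<in> H \<inter> N" for c
    using that unfolding normal_closure_def by (rule hull_inc)
  have inB: "a \<in> B" if "c \<in> ?A" "d \<in> ?D" "a \<in> carrier Fh" "(c \<otimes>\<^bsub>Fh\<^esub> d) M = a M" for a c d
  proof -
    have cd: "c \<otimes>\<^bsub>Fh\<^esub> d \<in> carrier Fh" using that by simp
    then have "inv\<^bsub>Fh\<^esub> (c \<otimes>\<^bsub>Fh\<^esub> d) \<otimes>\<^bsub>Fh\<^esub> a \<in> U M" using that M inv_mult_in_U by blast
    from mem_set_mult[OF mem_set_mult[OF that(1,2), of Fh] this, of Fh]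
    show ?thesis using Fh.inv_cancel(2)[OF cd that(3)] by (simp add: B_def)
  qed
  interpret h: group_hom Fh "F Mod M" "\<lambda>g. g M" by (rule comp_group_hom[OF M])
  have LN: "\<exists>b\<in>N. a M = b M" if "a \<in> ?L" for a
  proof -
    from that obtain b where "a \<in> carrier Fh" "b \<in> N" "a M' = b M'"
      unfolding normal_mult_U[OF N(1) M'(1)] by auto
    then show ?thesis using comp_eq_mono[of a b M' M] M M' N.subset by blast
  qed
  have derL: "derived Fh ?L \<subseteq> B"
    unfolding derived_def
  proof (rule Fh.generate_subgroup_incl[OF _ B.is_subgroup], safe)
    fix a1 a2 assume a: "a1 \<in> ?L" "a2 \<in> ?L"
    then obtain b1 b2 where b: "b1 \<in> N" "b2 \<in> N" "a1 M = b1 M" "a2 M = b2 M" using LN by metis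
    have c: "a1 \<in> carrier Fh" "a2 \<in> carrier Fh" "b1 \<in> carrier Fh" "b2 \<in> carrier Fh"
      using a b by auto
    let ?c = "\<lambda>a1 a2. a1 \<otimes>\<^bsub>Fh\<^esub> a2 \<otimes>\<^bsub>Fh\<^esub> inv\<^bsub>Fh\<^esub> a1 \<otimes>\<^bsub>Fh\<^esub> inv\<^bsub>Fh\<^esub> a2"
    have "(inv\<^bsub>Fh\<^esub> a1) M = (inv\<^bsub>Fh\<^esub> b1) M" "(inv\<^bsub>Fh\<^esub> a2) M = (inv\<^bsub>Fh\<^esub> b2) M"
      using h.hom_inv b c by simp_all
    then have eq: "(\<one>\<^bsub>Fh\<^esub> \<otimes>\<^bsub>Fh\<^esub> ?c b1 b2) M = ?c a1 a2 M"
      using b c M by simp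
    have D: "?c b1 b2 \<in> ?D"
      unfolding derived_def by (rule generate.incl) (use b in blast)
    show "?c a1 a2 \<in> B"
    proof (rule inB[OF A.one_closed])
      show "?c b1 b2 \<in> ?D" by (rule D)
      show "?c a1 a2 \<in> carrier Fh" using c by simp
    qed (rule eq)
  qed
  have HL: "H \<inter> ?L \<subseteq> B"
  proof
    fix a assume a: "a \<in> H \<inter> ?L"
    then obtain b where "b \<in> N" "a M' = b M'" unfolding normal_mult_U[OF N(1) M'(1)] by auto
    then obtain c where "c \<in> H \<inter> N" "c M = a M" using HN[of a b] a by auto
    then show "a \<in> B" using inB[OF inA D.one_closed, of c a] a by (simp add: N.mem_carrier)
  qed
  have U1: "U M \<subseteq> B"
  proof
    fix a assume "a \<in> U M"
    from mem_set_mult[OF mem_set_mult[OF A.one_closed D.one_closed, of Fh] this, of Fh]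
    show "a \<in> B" using \<open>a \<in> U M\<close> by (simp add: B_def)
  qed
  \<comment> \<open>The exponent \<open>k\<close> already kills the level \<open>M\<close>; it is increased by one so that \<open>q > 1\<close> even if
    the level is trivial.\<close>
  show thesis
  proof (rule that[OF M'])
    fix w :: "'c word" assume w: "set w \<subseteq> X \<times> UNIV"
      and dvd: "\<And>k' C. k' \<in> X - K \<Longrightarrow> C \<in> carrier (Fh Mod ?L) \<Longrightarrow>
        int (p ^ Suc k) dvd fox_count (\<lambda>u. ?L #>\<^bsub>Fh\<^esub> word_value Fh x u) k' w C"
    have "word_value Fh x w \<in> H <#>\<^bsub>Fh\<^esub> (B \<inter> ?L)"
    proof (rule Fh.word_in_product_if_counts_vanish[where X = X and K = K and L = ?L and q = "p ^ Suc k"])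
      show "B \<inter> ?L \<lhd> Fh"
        using Fh.normal_subgroup_intersect B.normal_axioms L.normal_axioms by blast
      show "derived Fh ?L \<subseteq> B \<inter> ?L"
        using derL Fh.derived_incl[OF _ L.is_subgroup] by blast
      show "1 < p ^ Suc k"
        using prime_gt_1_nat[OF prime_p] by (intro one_less_power) auto
      fix a assume a: "a \<in> ?L"
      have "(a [^]\<^bsub>Fh\<^esub> (p ^ k)) [^]\<^bsub>Fh\<^esub> p \<in> U M"
        using Fh.subgroup_nat_pow_closed[OF UM.is_subgroup] k a L.mem_carrier by blast
      moreover have "(a [^]\<^bsub>Fh\<^esub> (p ^ k)) [^]\<^bsub>Fh\<^esub> p = a [^]\<^bsub>Fh\<^esub> (p ^ Suc k)"
        using a by (simp add: Fh.nat_pow_pow L.mem_carrier mult.commute)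
      moreover have "a [^]\<^bsub>Fh\<^esub> (p ^ Suc k) \<in> ?L"
        using Fh.subgroup_nat_pow_closed[OF L.is_subgroup a] .
      ultimately show "a [^]\<^bsub>Fh\<^esub> (p ^ Suc k) \<in> B \<inter> ?L" using U1 by auto
    qed (use X K H(1) L.normal_axioms finite_index_mult_U[OF N(1) M'(1)] w dvd HL in auto)
    then obtain h b where hb: "h \<in> H" "b \<in> B" "word_value Fh x w = h \<otimes>\<^bsub>Fh\<^esub> b"
      by (auto simp: set_mult_def)
    then obtain c d u where cdu: "c \<in> ?A" "d \<in> ?D" "u \<in> U M" "b = c \<otimes>\<^bsub>Fh\<^esub> d \<otimes>\<^bsub>Fh\<^esub> u"
      unfolding B_def set_mult_def by blast
    let ?s = "h \<otimes>\<^bsub>Fh\<^esub> c \<otimes>\<^bsub>Fh\<^esub> d"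
    have s: "?s \<in> carrier Fh" using hb cdu by simp
    have "word_value Fh x w = ?s \<otimes>\<^bsub>Fh\<^esub> u"
      using hb cdu by (simp add: Fh.m_assoc)
    then have "inv\<^bsub>Fh\<^esub> ?s \<otimes>\<^bsub>Fh\<^esub> word_value Fh x w = u"
      using Fh.inv_cancel(1)[OF s, of u] cdu by simp
    then have "?s M = word_value Fh x w M"
      using inv_mult_in_U[OF s _ M, of "word_value Fh x w"] cdu Fh.word_value_closed[OF X(2) w]
      by simp
    moreover have "?s \<in> (H <#>\<^bsub>Fh\<^esub> ?A) <#>\<^bsub>Fh\<^esub> ?D"
      using hb cdu by (intro mem_set_mult)
    ultimately show "\<exists>s\<in>(H <#>\<^bsub>Fh\<^esub> ?A) <#>\<^bsub>Fh\<^esub> ?D. s \<in> carrier Fh \<and> s M = word_value Fh x w M"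
      using s by blast
  qed
qed

end

section \<open>Group rings over the \<open>p\<close>-adic integers and over the integers\<close>

lemma padic_carrier_iff:
  "a \<in> carrier (padic_ring p) \<longleftrightarrow>
    (\<forall>m. a m \<in> {0..<int p ^ m} \<and> a (Suc m) mod int p ^ m = a m)"
  by (simp add: padic_ring_def)

lemma padic_of_int_closed: "p > 0 \<Longrightarrow> padic_of_int p k \<in> carrier (padic_ring p)"
  by (auto simp: padic_carrier_iff padic_of_int_def mod_mod_cancel)

lemma padic_one: "\<one>\<^bsub>padic_ring p\<^esub> = padic_of_int p 1"
  by (simp add: padic_ring_def padic_of_int_def)

lemma padic_zero: "\<zero>\<^bsub>padic_ring p\<^esub> = padic_of_int p 0"
  by (simp add: padic_ring_def padic_of_int_def)

lemma padic_one_neq_zero: "p > 1 \<Longrightarrow> \<one>\<^bsub>padic_ring p\<^esub> \<noteq> \<zero>\<^bsub>padic_ring p\<^esub>"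
  by (auto simp: padic_ring_def fun_eq_iff intro!: exI[of _ 1])

lemma abelian_monoid_padic:
  assumes "p > 0"
  shows "abelian_monoid (padic_ring p)"
proof (rule abelian_monoidI)
  fix a b assume ab: "a \<in> carrier (padic_ring p)" "b \<in> carrier (padic_ring p)"
  have "((a (Suc m) + b (Suc m)) mod int p ^ Suc m) mod int p ^ m = (a m + b m) mod int p ^ m" for m
  proof -
    have "((a (Suc m) + b (Suc m)) mod int p ^ Suc m) mod int p ^ m =
        (a (Suc m) + b (Suc m)) mod int p ^ m"
      by (rule mod_mod_cancel) simp
    also have "\<dots> = (a (Suc m) mod int p ^ m + b (Suc m) mod int p ^ m) mod int p ^ m"
      by (simp add: mod_add_eq)
    finally show ?thesis using ab by (simp add: padic_carrier_iff)
  qed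
  then show "a \<oplus>\<^bsub>padic_ring p\<^esub> b \<in> carrier (padic_ring p)"
    using assms by (simp add: padic_carrier_iff) (simp add: padic_ring_def)
next
  fix a assume "a \<in> carrier (padic_ring p)"
  then show "\<zero>\<^bsub>padic_ring p\<^esub> \<oplus>\<^bsub>padic_ring p\<^esub> a = a"
    by (auto simp: padic_ring_def fun_eq_iff)
qed (use assms in \<open>auto simp: padic_ring_def fun_eq_iff mod_simps ac_simps\<close>)

lemma finsum_padic:
  assumes "p > 0" "f \<in> A \<rightarrow> carrier (padic_ring p)"
  shows "finsum (padic_ring p) f A m = (\<Sum>x\<in>A. f x m) mod int p ^ m"
proof -
  interpret abelian_monoid "padic_ring p" by (rule abelian_monoid_padic[OF assms(1)])
  show ?thesis
    using assms(2)
  proof (induction A rule: infinite_finite_induct)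
    case (insert x A)
    then have "finsum (padic_ring p) f (insert x A) = f x \<oplus>\<^bsub>padic_ring p\<^esub> finsum (padic_ring p) f A"
      by (intro finsum_insert) auto
    with insert show ?case by (simp add: padic_ring_def mod_simps)
  qed (simp_all add: padic_zero padic_of_int_def)
qed

lemma finsum_singleton_set:
  assumes "abelian_monoid R" "f a \<in> carrier R"
  shows "finsum R f {a} = f a"
proof -
  interpret abelian_monoid R by fact
  show ?thesis using assms(2) finsum_insert[of "{}" a f] by simp
qed

lemma group_ring_map_of:
  assumes R: "abelian_monoid R" "\<one>\<^bsub>R\<^esub> \<in> carrier R" "\<one>\<^bsub>R\<^esub> \<noteq> \<zero>\<^bsub>R\<^esub>" and g: "g \<in> carrier G"
  shows "group_ring_map R G H \<phi> (group_ring_of R G g) = group_ring_of R H (\<phi> g)"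
proof -
  interpret abelian_monoid R by fact
  have "finsum R (group_ring_of R G g) {x \<in> carrier G. group_ring_of R G g x \<noteq> \<zero>\<^bsub>R\<^esub> \<and> \<phi> x = y} =
      (if y = \<phi> g then \<one>\<^bsub>R\<^esub> else \<zero>\<^bsub>R\<^esub>)" for y
  proof (cases "y = \<phi> g")
    case True
    then have "{x \<in> carrier G. group_ring_of R G g x \<noteq> \<zero>\<^bsub>R\<^esub> \<and> \<phi> x = y} = {g}"
      using g R(3) by (auto simp: group_ring_of_def)
    then show ?thesis
      using True g R finsum_singleton_set[of R "group_ring_of R G g" g] by (simp add: group_ring_of_def)
  next
    case False
    then have "{x \<in> carrier G. group_ring_of R G g x \<noteq> \<zero>\<^bsub>R\<^esub> \<and> \<phi> x = y} = {}"
      by (auto simp: group_ring_of_def)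
    then show ?thesis using False by (simp only: finsum_empty if_False)
  qed
  then show ?thesis by (simp add: group_ring_map_def group_ring_of_def cong: restrict_cong)
qed

lemma group_ring_map_inj:
  assumes R: "abelian_monoid R" and f: "f \<in> carrier (group_ring R G)"
    and \<phi>: "inj_on \<phi> (carrier G)" "\<phi> ` carrier G \<subseteq> carrier H"
    and zero: "group_ring_map R G H \<phi> f = \<zero>\<^bsub>group_ring R H\<^esub>" and x: "x \<in> carrier G"
  shows "f x = \<zero>\<^bsub>R\<^esub>"
proof (rule ccontr)
  assume "f x \<noteq> \<zero>\<^bsub>R\<^esub>"
  then have "{z \<in> carrier G. f z \<noteq> \<zero>\<^bsub>R\<^esub> \<and> \<phi> z = \<phi> x} = {x}"
    using x \<phi>(1) by (auto dest: inj_onD)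
  moreover have "f x \<in> carrier R" using f x by (auto simp: group_ring_def)
  moreover have "\<phi> x \<in> carrier H" using \<phi>(2) x by blast
  ultimately have "group_ring_map R G H \<phi> f (\<phi> x) = f x"
    using finsum_singleton_set[OF R] by (simp add: group_ring_map_def)
  then show False
    using zero \<open>f x \<noteq> \<zero>\<^bsub>R\<^esub>\<close> \<open>\<phi> x \<in> carrier H\<close> by (simp add: group_ring_def)
qed

lemma group_ring_of_closed:
  assumes "\<one>\<^bsub>R\<^esub> \<in> carrier R" "\<zero>\<^bsub>R\<^esub> \<in> carrier R"
  shows "group_ring_of R G g \<in> carrier (group_ring R G)"
proof -
  have "finite {x \<in> carrier G. group_ring_of R G g x \<noteq> \<zero>\<^bsub>R\<^esub>}"
    by (rule finite_subset[of _ "{g}"]) (auto simp: group_ring_of_def)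
  then show ?thesis using assms by (auto simp: group_ring_def group_ring_of_def)
qed

text \<open>Multiplication by group elements from the right is all that is needed to evaluate
  \<open>D(uv) = D(u)v + \<epsilon>(u)D(v)\<close> on group elements.\<close>

lemma (in group) int_group_ring_mult_of:
  assumes f: "f \<in> carrier (group_ring \<Z> G)" and g: "g \<in> carrier G" and z: "z \<in> carrier G"
  shows "(f \<otimes>\<^bsub>group_ring \<Z> G\<^esub> group_ring_of \<Z> G g) z = f (z \<otimes> inv g)"
proof -
  let ?S = "{x \<in> carrier G. f x \<noteq> 0}"
  have fin: "finite ?S" using f by (simp add: group_ring_def)
  have "(f \<otimes>\<^bsub>group_ring \<Z> G\<^esub> group_ring_of \<Z> G g) z = (\<Sum>x\<in>?S. f x * group_ring_of \<Z> G g (inv x \<otimes> z))"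
    using z by (simp add: group_ring_def int_finsum_eq)
  also have "\<dots> = (\<Sum>x\<in>?S. if x = z \<otimes> inv g then f x else 0)"
  proof (rule sum.cong)
    fix x assume x: "x \<in> ?S"
    have "inv x \<otimes> z = g \<longleftrightarrow> x = z \<otimes> inv g"
      using x g z inv_solve_left[of g x z] inv_solve_right[of x z g] by auto
    then show "f x * group_ring_of \<Z> G g (inv x \<otimes> z) = (if x = z \<otimes> inv g then f x else 0)"
      using x z by (auto simp: group_ring_of_def)
  qed simp
  also have "\<dots> = f (z \<otimes> inv g)" using fin g z by auto
  finally show ?thesis .
qed

lemma int_group_ring_add_apply:
  "z \<in> carrier G \<Longrightarrow> (f \<oplus>\<^bsub>group_ring \<Z> G\<^esub> h) z = f z + h z"
  by (simp add: group_ring_def)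

lemma augmentation_of: "g \<in> carrier G \<Longrightarrow> augmentation \<Z> G (group_ring_of \<Z> G g) = 1"
proof -
  assume g: "g \<in> carrier G"
  then have "{x \<in> carrier G. group_ring_of \<Z> G g x \<noteq> 0} = {g}"
    by (auto simp: group_ring_of_def)
  then show ?thesis using g by (simp add: augmentation_def int_finsum_eq group_ring_of_def)
qed

lemma (in group) int_group_ring_of_mult:
  assumes "g \<in> carrier G" "h \<in> carrier G"
  shows "group_ring_of \<Z> G g \<otimes>\<^bsub>group_ring \<Z> G\<^esub> group_ring_of \<Z> G h = group_ring_of \<Z> G (g \<otimes> h)"
    (is "?l = ?r")
proof (rule extensionalityI[of _ "carrier G"])
  fix z assume z: "z \<in> carrier G"
  have "?l z = group_ring_of \<Z> G g (z \<otimes> inv h)"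
    using assms z by (intro int_group_ring_mult_of group_ring_of_closed) auto
  also have "z \<otimes> inv h = g \<longleftrightarrow> z = g \<otimes> h"
    using assms z inv_solve_right[of g z h] by auto
  then have "group_ring_of \<Z> G g (z \<otimes> inv h) = ?r z"
    using assms z by (simp add: group_ring_of_def)
  finally show "?l z = ?r z" .
qed (simp_all add: group_ring_def group_ring_of_def)

section \<open>Fox derivatives of words\<close>

lemma fox_count_cong:
  assumes "\<And>u. suffix u w \<Longrightarrow> cls u = cls' u"
  shows "fox_count cls k w C = fox_count cls' k w C"
  using assms
proof (induction w)
  case (Cons a u)
  obtain j b where a: "a = (j, b)" by force
  have "cls u = cls' u" "cls (a # u) = cls' (a # u)" using Cons.prems by (auto simp: suffix_def)
  moreover have "fox_count cls k u C = fox_count cls' k u C"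
    by (rule Cons.IH) (simp add: Cons.prems suffix_Cons)
  ultimately show ?case by (auto simp: a)
qed simp

text \<open>Passing from \<open>\<int>[F]\<close> to the group ring of a quotient of \<open>F\<close> sums the coefficients over the classes.
  The set \<open>A\<close> need only contain the support of the coefficients, which consists of suffixes of \<open>w\<close>.\<close>

lemma fox_count_eq_sum:
  assumes "finite A" "\<And>u. suffix u w \<Longrightarrow> u \<in> A"
  shows "fox_count cls k w C = (\<Sum>u\<in>{u \<in> A. cls u = C}. fox_count (\<lambda>u. u) k w u)"
  using assms(2)
proof (induction w)
  case (Cons a u)
  obtain j b where a: "a = (j, b)" by force
  have mem: "u \<in> A" "a # u \<in> A" using Cons.prems by (auto simp: suffix_def)
  have IH: "fox_count cls k u C = (\<Sum>u'\<in>{u \<in> A. cls u = C}. fox_count (\<lambda>u. u) k u u')"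
    by (rule Cons.IH) (simp add: Cons.prems suffix_Cons)
  have delta: "(\<Sum>u'\<in>{u \<in> A. cls u = C}. of_bool (v = u')) = (of_bool (cls v = C) :: int)"
    if "v \<in> A" for v
  proof -
    have "(\<Sum>u'\<in>{u \<in> A. cls u = C}. of_bool (v = u')) = (\<Sum>u'\<in>{u \<in> A. cls u = C}. if v = u' then 1 else (0::int))"
      by (intro sum.cong) auto
    then show ?thesis using that assms(1) by simp
  qed
  show ?case
    using delta[OF mem(1)] delta[OF mem(2)]
    by (cases "j = k"; cases b) (simp_all add: a IH sum.distrib sum_subtractf)
qed simp

lemma fox_count_eq_0: "\<not> suffix u w \<Longrightarrow> fox_count (\<lambda>u. u) k w u = 0"
proof (induction w)
  case (Cons a w)
  obtain j b where a: "a = (j, b)" by force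
  show ?case using Cons by (auto simp: a suffix_Cons)
qed simp

lemma suffix_FG: "suffix u w \<Longrightarrow> w \<in> carrier (free_group X) \<Longrightarrow> u \<in> carrier (free_group X)"
proof (induction w)
  case (Cons a w)
  then show ?case using reduced_tl[of a w] by (auto simp: suffix_Cons free_group_def)
qed (simp add: free_group_def)

lemma Cons_eq_mult:
  assumes "a # u \<in> carrier (free_group X)"
  shows "a # u = [a] \<otimes>\<^bsub>free_group X\<^esub> u"
proof -
  have "reduced (a # u)" using assms by (simp add: free_group_def)
  from cons_reduce_reduced[OF this] show ?thesis by (simp add: free_group_def)
qed

lemma inv_letter:
  assumes "j \<in> X" shows "inv\<^bsub>free_group X\<^esub> [(j, True)] = [(j, False)]"
proof -
  interpret group "free_group X" by (rule group_free_group)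
  show ?thesis
    by (rule inv_equality) (use assms in \<open>auto simp: free_group_def\<close>)
qed

text \<open>The product rule gives \<open>D(1) = 0\<close>, and then \<open>D(x\<inverse>) = - D(x) x\<inverse>\<close> from \<open>x x\<inverse> = 1\<close>. Splitting off the
  first letter of a word now yields the recursion of \<open>fox_count\<close>; since the word is reduced, its
  suffixes are the group elements they denote.\<close>

lemma fox_derivative_word:
  assumes D: "fox_derivative n k D" and w: "w \<in> carrier (FG n)" and k: "k \<in> {1..n}"
  shows "D (group_ring_of \<Z> (FG n) w) = (\<lambda>z\<in>carrier (FG n). fox_count (\<lambda>u. u) k w z)"
proof -
  interpret G: group "FG n" unfolding FG_def by (rule group_free_group)
  let ?A = "group_ring \<Z> (FG n)"
  let ?e = "group_ring_of \<Z> (FG n)"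
  have e: "?e g \<in> carrier ?A" for g by (rule group_ring_of_closed) auto
  have DA: "D (?e g) \<in> carrier ?A" for g
    using D e unfolding fox_derivative_def Let_def by blast
  have prod: "D (?e (g \<otimes>\<^bsub>FG n\<^esub> h)) z = D (?e g) (z \<otimes>\<^bsub>FG n\<^esub> inv\<^bsub>FG n\<^esub> h) + D (?e h) z"
    if "g \<in> carrier (FG n)" "h \<in> carrier (FG n)" "z \<in> carrier (FG n)" for g h z
  proof -
    have "D (?e g \<otimes>\<^bsub>?A\<^esub> ?e h) = D (?e g) \<otimes>\<^bsub>?A\<^esub> ?e h \<oplus>\<^bsub>?A\<^esub> [augmentation \<Z> (FG n) (?e g)] \<cdot>\<^bsub>?A\<^esub> D (?e h)"
      using D e unfolding fox_derivative_def Let_def by blast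
    also have "augmentation \<Z> (FG n) (?e g) = 1" using that by (intro augmentation_of)
    also have "[(1::int)] \<cdot>\<^bsub>?A\<^esub> D (?e h) = \<zero>\<^bsub>?A\<^esub> \<oplus>\<^bsub>?A\<^esub> D (?e h)"
      by (simp add: add_pow_def int_pow_def2 nat_pow_def)
    also have "?e g \<otimes>\<^bsub>?A\<^esub> ?e h = ?e (g \<otimes>\<^bsub>FG n\<^esub> h)"
      using that by (intro G.int_group_ring_of_mult)
    finally show ?thesis
      using that G.int_group_ring_mult_of[OF DA that(2,3)]
      by (simp add: int_group_ring_add_apply) (simp add: group_ring_def)
  qed
  have one: "D (?e \<one>\<^bsub>FG n\<^esub>) z = 0" if "z \<in> carrier (FG n)" for z
    using prod[of "\<one>\<^bsub>FG n\<^esub>" "\<one>\<^bsub>FG n\<^esub>" z] that by simp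
  have gen: "D (?e [(j, True)]) z = of_bool (j = k \<and> z = \<one>\<^bsub>FG n\<^esub>)"
    if "j \<in> {1..n}" "z \<in> carrier (FG n)" for j z
  proof -
    have "D (?e [(j, True)]) = (if j = k then \<one>\<^bsub>?A\<^esub> else \<zero>\<^bsub>?A\<^esub>)"
      using D that k unfolding fox_derivative_def Let_def FG_gen_def by auto
    then show ?thesis using that by (auto simp: group_ring_def)
  qed
  have letter: "[(j, b)] \<in> carrier (FG n)" if "j \<in> {1..n}" for j b
    using that by (simp add: FG_def free_group_def)
  have ginv: "inv\<^bsub>FG n\<^esub> [(j, True)] = [(j, False)]" if "j \<in> {1..n}" for j
    unfolding FG_def using that by (rule inv_letter)
  have "D (?e w) z = fox_count (\<lambda>u. u) k w z" if z: "z \<in> carrier (FG n)" for z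
    using w
  proof (induction w)
    case Nil
    then show ?case using one[OF z] by (simp add: FG_def free_group_def)
  next
    case (Cons a u)
    obtain j b where a: "a = (j, b)" by force
    have j: "j \<in> {1..n}" using Cons.prems by (auto simp: a FG_def free_group_def)
    have u: "u \<in> carrier (FG n)"
      using suffix_FG[of u "a # u"] Cons.prems by (simp add: FG_def suffix_Cons)
    have split: "a # u = [a] \<otimes>\<^bsub>FG n\<^esub> u"
      using Cons_eq_mult Cons.prems by (simp add: FG_def)
    define y where "y = z \<otimes>\<^bsub>FG n\<^esub> inv\<^bsub>FG n\<^esub> u"
    have y: "y \<in> carrier (FG n)" using z u by (simp add: y_def)
    have Da: "D (?e [a]) y = (if j = k then if b then of_bool (u = z) else - of_bool (a # u = z) else 0)"
    proof (cases b)
      case True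
      have "y = \<one>\<^bsub>FG n\<^esub> \<longleftrightarrow> u = z"
        using G.inv_solve_right[of "\<one>\<^bsub>FG n\<^esub>" z u] z u by (auto simp: y_def)
      then show ?thesis using gen[OF j y] True by (simp add: a)
    next
      case False
      let ?x = "[(j, True)]"
      have ax: "[a] = inv\<^bsub>FG n\<^esub> ?x" using ginv[OF j] False by (simp add: a)
      have "D (?e (?x \<otimes>\<^bsub>FG n\<^esub> [a])) y = D (?e ?x) (y \<otimes>\<^bsub>FG n\<^esub> inv\<^bsub>FG n\<^esub> [a]) + D (?e [a]) y"
        using letter[OF j] y by (intro prod) (simp_all add: a)
      then have "D (?e [a]) y = - D (?e ?x) (y \<otimes>\<^bsub>FG n\<^esub> ?x)"
        using one[OF y] letter[OF j] by (simp add: ax)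
      also have "\<dots> = - of_bool (j = k \<and> y \<otimes>\<^bsub>FG n\<^esub> ?x = \<one>\<^bsub>FG n\<^esub>)"
        using gen[OF j, of "y \<otimes>\<^bsub>FG n\<^esub> ?x"] y letter[OF j] by simp
      also have "y \<otimes>\<^bsub>FG n\<^esub> ?x = \<one>\<^bsub>FG n\<^esub> \<longleftrightarrow> a # u = z"
      proof -
        have "y \<otimes>\<^bsub>FG n\<^esub> ?x = \<one>\<^bsub>FG n\<^esub> \<longleftrightarrow> y = inv\<^bsub>FG n\<^esub> ?x"
          using G.inv_equality[of y ?x] y letter[OF j] by auto
        also have "\<dots> \<longleftrightarrow> z = inv\<^bsub>FG n\<^esub> ?x \<otimes>\<^bsub>FG n\<^esub> u"
          using G.inv_solve_right[of "inv\<^bsub>FG n\<^esub> ?x" z u] z u letter[OF j] by (auto simp: y_def)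
        finally show ?thesis using split ax by auto
      qed
      finally show ?thesis using False by auto
    qed
    have "D (?e (a # u)) z = D (?e [a]) y + D (?e u) z"
      unfolding split y_def by (rule prod) (use letter[OF j] u z in \<open>simp_all add: a\<close>)
    then show ?case using Da Cons.IH[OF u] by (auto simp: a)
  qed
  moreover have "D (?e w) \<in> extensional (carrier (FG n))"
    using DA[of w] by (auto simp: group_ring_def PiE_def)
  ultimately show ?thesis
    by (intro extensionalityI[of _ "carrier (FG n)"]) auto
qed

section \<open>Completed group rings\<close>

lemma padic_topspace: "topspace (padic_topology p) = carrier (padic_ring p)"
  by (auto simp: padic_topology_def padic_carrier_iff)

lemma padic_closed:
  assumes "prime p"
  shows "\<one>\<^bsub>padic_ring p\<^esub> \<in> carrier (padic_ring p)" "\<zero>\<^bsub>padic_ring p\<^esub> \<in> carrier (padic_ring p)"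
    "\<one>\<^bsub>padic_ring p\<^esub> \<noteq> \<zero>\<^bsub>padic_ring p\<^esub>" "abelian_monoid (padic_ring p)"
  using prime_gt_1_nat[OF assms]
  by (simp_all add: padic_one_neq_zero abelian_monoid_padic)
    (simp_all add: padic_one padic_zero padic_of_int_closed)

lemma openin_ball_finite:
  assumes "finite P" "\<And>z. z \<in> P \<Longrightarrow> openin X {x \<in> topspace X. Q z x}"
  shows "openin X {x \<in> topspace X. \<forall>z\<in>P. Q z x}"
  using assms
proof (induction P)
  case (insert z P)
  then have "openin X ({x \<in> topspace X. Q z x} \<inter> {x \<in> topspace X. \<forall>z\<in>P. Q z x})" by auto
  also have "{x \<in> topspace X. Q z x} \<inter> {x \<in> topspace X. \<forall>z\<in>P. Q z x} =
      {x \<in> topspace X. \<forall>z\<in>insert z P. Q z x}" by auto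
  finally show ?case .
qed simp

lemma carrier_completed_group_ring:
  "carrier (completed_group_ring p G T) =
    {f \<in> \<Pi>\<^sub>E V\<in>open_normals G T. carrier (group_ring (padic_ring p) (G Mod V)).
      \<forall>U\<in>open_normals G T. \<forall>V\<in>open_normals G T. U \<subseteq> V \<longrightarrow>
        f V = group_ring_map (padic_ring p) (G Mod U) (G Mod V) (\<lambda>C. V <#>\<^bsub>G\<^esub> C) (f U)}"
  by (simp only: completed_group_ring_def Let_def partial_object.simps)

context pro_p
begin

text \<open>The class modulo an open normal subgroup is determined by one component. So every function of
  that class is continuous, whatever the topology of its target.\<close>

lemma open_normal_level:
  assumes "V \<in> open_normals Fh T"
  shows "\<exists>M\<in>I. \<forall>g\<in>carrier Fh. \<forall>h\<in>carrier Fh. h M = g M \<longrightarrow> V #>\<^bsub>Fh\<^esub> h = V #>\<^bsub>Fh\<^esub> g"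
proof -
  have V: "V \<lhd> Fh" "openin T V" using assms by (auto simp: open_normals_def)
  interpret V: normal V Fh by (rule V(1))
  obtain M where M: "M \<in> I" "\<forall>h\<in>carrier Fh. h M = \<one>\<^bsub>Fh\<^esub> M \<longrightarrow> h \<in> V"
    using V(2) V.one_closed unfolding openin_T by meson
  interpret h: group_hom Fh "F Mod M" "\<lambda>g. g M" by (rule comp_group_hom[OF M(1)])
  have "V #>\<^bsub>Fh\<^esub> h = V #>\<^bsub>Fh\<^esub> g" if gh: "g \<in> carrier Fh" "h \<in> carrier Fh" "h M = g M" for g h
  proof -
    have "(h \<otimes>\<^bsub>Fh\<^esub> inv\<^bsub>Fh\<^esub> g) M = \<one>\<^bsub>Fh\<^esub> M"
      using gh h.hom_mult[of h "inv\<^bsub>Fh\<^esub> g"] h.hom_mult[of g "inv\<^bsub>Fh\<^esub> g"] M(1) by simp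
    then have "h \<otimes>\<^bsub>Fh\<^esub> inv\<^bsub>Fh\<^esub> g \<in> V" using M(2) gh by simp
    then have "h \<in> V #>\<^bsub>Fh\<^esub> g" using V.rcos_module_rev[OF group_Fh] gh by simp
    then show ?thesis using Fh.repr_independence[OF _ gh(1) V.is_subgroup] by simp
  qed
  then show ?thesis using M(1) by blast
qed

lemma continuous_map_coset:
  assumes V: "V \<in> open_normals Fh T" and f: "f \<in> carrier Fh \<rightarrow> topspace Y"
    and coset: "\<And>g h. V #>\<^bsub>Fh\<^esub> g = V #>\<^bsub>Fh\<^esub> h \<Longrightarrow> f g = f h"
  shows "continuous_map T Y f"
proof -
  obtain M where M: "M \<in> I"
    "\<And>g h. g \<in> carrier Fh \<Longrightarrow> h \<in> carrier Fh \<Longrightarrow> h M = g M \<Longrightarrow> V #>\<^bsub>Fh\<^esub> h = V #>\<^bsub>Fh\<^esub> g"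
    using open_normal_level[OF V] by meson
  have "openin T {g \<in> carrier Fh. f g \<in> S}" for S
  proof (rule openin_compI[OF M(1)])
    fix g h assume g: "g \<in> {g \<in> carrier Fh. f g \<in> S}" and h: "h \<in> carrier Fh" "h M = g M"
    then have "V #>\<^bsub>Fh\<^esub> h = V #>\<^bsub>Fh\<^esub> g" by (intro M(2)) simp_all
    from coset[OF this] show "h \<in> {g \<in> carrier Fh. f g \<in> S}" using g h by simp
  qed simp
  then show ?thesis using f by (simp add: continuous_map_def)
qed

lemma completed_group_ring_of_closed:
  assumes g: "g \<in> carrier Fh"
  shows "completed_group_ring_of p Fh T g \<in> carrier (completed_group_ring p Fh T)"
proof -
  note R = padic_closed[OF prime_p]
  have compat: "group_ring_of (padic_ring p) (Fh Mod V) (V #>\<^bsub>Fh\<^esub> g) =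
      group_ring_map (padic_ring p) (Fh Mod U) (Fh Mod V) (\<lambda>C. V <#>\<^bsub>Fh\<^esub> C)
        (group_ring_of (padic_ring p) (Fh Mod U) (U #>\<^bsub>Fh\<^esub> g))"
    if "U \<in> open_normals Fh T" "V \<in> open_normals Fh T" "U \<subseteq> V" for U V
  proof -
    have nU: "U \<lhd> Fh" and nV: "V \<lhd> Fh" using that by (auto simp: open_normals_def)
    interpret U: normal U Fh by (rule nU)
    interpret V: normal V Fh by (rule nV)
    have "V <#>\<^bsub>Fh\<^esub> U = V"
    proof
      show "V <#>\<^bsub>Fh\<^esub> U \<subseteq> V" using that(3) by (auto simp: set_mult_def)
      show "V \<subseteq> V <#>\<^bsub>Fh\<^esub> U"
        using mem_set_mult[OF _ U.one_closed, of _ V Fh] by fastforce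
    qed
    then have "V <#>\<^bsub>Fh\<^esub> (U #>\<^bsub>Fh\<^esub> g) = V #>\<^bsub>Fh\<^esub> g"
      using Fh.setmult_rcos_assoc[OF V.subset U.subset g] by simp
    moreover have "U #>\<^bsub>Fh\<^esub> g \<in> carrier (Fh Mod U)" using g by (auto simp: carrier_FactGroup)
    ultimately show ?thesis
      using group_ring_map_of[OF R(4,1,3), of "U #>\<^bsub>Fh\<^esub> g" "Fh Mod U" "Fh Mod V"] by simp
  qed
  show ?thesis
    unfolding carrier_completed_group_ring completed_group_ring_of_def
  proof (intro CollectI conjI ballI impI)
    show "(\<lambda>U\<in>open_normals Fh T. group_ring_of (padic_ring p) (Fh Mod U) (U #>\<^bsub>Fh\<^esub> g))
        \<in> (\<Pi>\<^sub>E V\<in>open_normals Fh T. carrier (group_ring (padic_ring p) (Fh Mod V)))"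
      by (auto simp: restrict_PiE_iff intro!: group_ring_of_closed R)
  next
    fix U V assume UV: "U \<in> open_normals Fh T" "V \<in> open_normals Fh T" "U \<subseteq> V"
    show "(\<lambda>U\<in>open_normals Fh T. group_ring_of (padic_ring p) (Fh Mod U) (U #>\<^bsub>Fh\<^esub> g)) V =
        group_ring_map (padic_ring p) (Fh Mod U) (Fh Mod V) (\<lambda>C. V <#>\<^bsub>Fh\<^esub> C)
          ((\<lambda>U\<in>open_normals Fh T. group_ring_of (padic_ring p) (Fh Mod U) (U #>\<^bsub>Fh\<^esub> g)) U)"
      unfolding restrict_apply'[OF UV(1)] restrict_apply'[OF UV(2)] by (rule compat[OF UV])
  qed
qed

lemma completed_group_ring_comp_closed:
  assumes "f \<in> carrier (completed_group_ring p Fh T)" "V \<in> open_normals Fh T"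
  shows "f V \<in> carrier (group_ring (padic_ring p) (Fh Mod V))"
  using assms unfolding carrier_completed_group_ring by blast

lemma topspace_completed_group_ring:
  "topspace (completed_group_ring_topology p Fh T) = carrier (completed_group_ring p Fh T)"
proof -
  have "carrier (completed_group_ring p Fh T) \<subseteq>
      (\<Pi>\<^sub>E V\<in>open_normals Fh T. carrier (Fh Mod V) \<rightarrow>\<^sub>E carrier (padic_ring p))"
  proof -
    have "carrier (group_ring (padic_ring p) (Fh Mod V)) \<subseteq> carrier (Fh Mod V) \<rightarrow>\<^sub>E carrier (padic_ring p)"
      for V by (auto simp: group_ring_def)
    then have "(\<Pi>\<^sub>E V\<in>open_normals Fh T. carrier (group_ring (padic_ring p) (Fh Mod V))) \<subseteq>
        (\<Pi>\<^sub>E V\<in>open_normals Fh T. carrier (Fh Mod V) \<rightarrow>\<^sub>E carrier (padic_ring p))"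
      by (intro PiE_mono) blast
    then show ?thesis unfolding carrier_completed_group_ring by blast
  qed
  then show ?thesis
    by (simp add: completed_group_ring_topology_def padic_topspace Int_absorb1)
qed

lemma continuous_completed_group_ring_of:
  "continuous_map T (completed_group_ring_topology p Fh T) (completed_group_ring_of p Fh T)"
  unfolding completed_group_ring_topology_def
proof (rule continuous_map_into_subtopology)
  show "completed_group_ring_of p Fh T \<in> topspace T \<rightarrow> carrier (completed_group_ring p Fh T)"
    using completed_group_ring_of_closed by simp
  show "continuous_map T (product_topology (\<lambda>V. product_topology (\<lambda>_. padic_topology p)
      (carrier (Fh Mod V))) (open_normals Fh T)) (completed_group_ring_of p Fh T)"
  proof (rule continuous_map_coordinatewise_then_product)
    fix V assume V: "V \<in> open_normals Fh T"
    show "continuous_map T (product_topology (\<lambda>_. padic_topology p) (carrier (Fh Mod V)))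
        (\<lambda>g. completed_group_ring_of p Fh T g V)"
    proof (rule continuous_map_coordinatewise_then_product)
      fix C assume C: "C \<in> carrier (Fh Mod V)"
      show "continuous_map T (padic_topology p) (\<lambda>g. completed_group_ring_of p Fh T g V C)"
        by (rule continuous_map_coset[OF V])
          (use V C padic_closed[OF prime_p] in
            \<open>auto simp: completed_group_ring_of_def group_ring_of_def padic_topspace\<close>)
    qed (use V in \<open>simp add: completed_group_ring_of_def group_ring_of_def\<close>)
  qed (simp add: completed_group_ring_of_def)
qed

lemma continuous_coefficient:
  assumes V: "V \<in> open_normals Fh T" and C: "C \<in> carrier (Fh Mod V)"
  shows "continuous_map (completed_group_ring_topology p Fh T)
    (discrete_topology {0..<int p ^ m}) (\<lambda>f. f V C m)"
proof -
  let ?P = "product_topology (\<lambda>V. product_topology (\<lambda>_. padic_topology p)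
      (carrier (Fh Mod V))) (open_normals Fh T)"
  have "continuous_map ?P (product_topology (\<lambda>_. padic_topology p) (carrier (Fh Mod V))) (\<lambda>f. f V)"
    using V by (rule continuous_map_product_coordinates)
  then have "continuous_map ?P (padic_topology p) (\<lambda>f. f V C)"
    using C by (rule continuous_map_product_then_coordinatewise)
  moreover have "continuous_map (padic_topology p) (discrete_topology {0..<int p ^ m}) (\<lambda>a. a m)"
    unfolding padic_topology_def
    by (intro continuous_map_from_subtopology continuous_map_product_coordinates) simp
  ultimately have "continuous_map ?P (discrete_topology {0..<int p ^ m}) ((\<lambda>a. a m) \<circ> (\<lambda>f. f V C))"
    by (rule continuous_map_compose)
  then show ?thesis
    unfolding completed_group_ring_topology_def o_def by (rule continuous_map_from_subtopology)
qed

text \<open>Let \<open>W = L/N\<close>. As \<open>(G/N)/W\<close> is \<open>G/L\<close>, the component at \<open>W\<close> of the image of \<open>f\<close> has the same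
  coefficients as the component of \<open>f\<close> at \<open>L\<close>, relabelled by the injection \<open>\<Theta>\<close>.\<close>

lemma projection_zero_imp_coefficient_zero:
  assumes N: "N \<lhd> Fh" and L: "L \<lhd> Fh" "N \<subseteq> L" "openin T L"
    and f: "f \<in> carrier (completed_group_ring p Fh T)"
    and zero: "completed_group_ring_map p Fh (Fh Mod N)
        (quotient_topology T (\<lambda>g. N #>\<^bsub>Fh\<^esub> g)) (\<lambda>g. N #>\<^bsub>Fh\<^esub> g) f =
      \<zero>\<^bsub>completed_group_ring p (Fh Mod N) (quotient_topology T (\<lambda>g. N #>\<^bsub>Fh\<^esub> g))\<^esub>"
    and C: "C \<in> carrier (Fh Mod L)"
  shows "f L C = \<zero>\<^bsub>padic_ring p\<^esub>"
proof -
  interpret N: normal N Fh by fact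
  interpret L: normal L Fh by fact
  interpret Q: group "Fh Mod N" by (rule N.factorgroup_is_group)
  let ?\<phi> = "\<lambda>g. N #>\<^bsub>Fh\<^esub> g"
  let ?qT = "quotient_topology T ?\<phi>"
  define W where "W = ?\<phi> ` L"
  interpret h: group_hom Fh "Fh Mod N" ?\<phi>
    by (intro group_hom.intro group_hom_axioms.intro group_Fh Q.is_group N.r_coset_hom_Mod)
  have W: "W \<lhd> Fh Mod N"
    unfolding W_def
    by (rule L.surj_hom_normal_subgroup[OF h.group_hom_axioms]) (simp add: carrier_FactGroup)
  interpret W: normal W "Fh Mod N" by (rule W)
  have coset: "?\<phi> g = ?\<phi> h \<Longrightarrow> \<exists>a\<in>N. g = a \<otimes>\<^bsub>Fh\<^esub> h"
    if "g \<in> carrier Fh" for g h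
    using Fh.rcos_self[OF that N.is_subgroup] by (auto simp: r_coset_def)
  have pre: "{g \<in> carrier Fh. ?\<phi> g \<in> W} = L"
  proof (intro equalityI subsetI)
    fix g assume "g \<in> {g \<in> carrier Fh. ?\<phi> g \<in> W}"
    then obtain l where l: "g \<in> carrier Fh" "l \<in> L" "?\<phi> g = ?\<phi> l" by (auto simp: W_def)
    then obtain a where "a \<in> N" "g = a \<otimes>\<^bsub>Fh\<^esub> l" using coset by blast
    then show "g \<in> L" using L(2) l by auto
  qed (auto simp: W_def)
  have Wo: "W \<in> open_normals (Fh Mod N) ?qT"
    using W L(3) pre unfolding open_normals_def openin_quotient_topology
    by (auto simp: W_def)
  have Lo: "L \<in> open_normals Fh T" using L by (simp add: open_normals_def)
  let ?\<Theta> = "\<lambda>C. W <#>\<^bsub>Fh Mod N\<^esub> ?\<phi> ` C"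
  have \<Theta>: "?\<Theta> (L #>\<^bsub>Fh\<^esub> g) = W #>\<^bsub>Fh Mod N\<^esub> ?\<phi> g" if g: "g \<in> carrier Fh" for g
  proof -
    have "L #>\<^bsub>Fh\<^esub> g = (\<lambda>l. l \<otimes>\<^bsub>Fh\<^esub> g) ` L" by (auto simp: r_coset_def)
    then have "?\<phi> ` (L #>\<^bsub>Fh\<^esub> g) = (\<lambda>l. ?\<phi> (l \<otimes>\<^bsub>Fh\<^esub> g)) ` L" by (simp only: image_image)
    also have "\<dots> = (\<lambda>l. ?\<phi> l <#>\<^bsub>Fh\<^esub> ?\<phi> g) ` L"
      by (rule image_cong[OF refl], rule N.rcos_sum[symmetric]) (use g in simp_all)
    also have "\<dots> = W #>\<^bsub>Fh Mod N\<^esub> ?\<phi> g" by (auto simp: W_def r_coset_def)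
    finally have eq: "?\<phi> ` (L #>\<^bsub>Fh\<^esub> g) = W #>\<^bsub>Fh Mod N\<^esub> ?\<phi> g" .
    have "W #>\<^bsub>Fh Mod N\<^esub> ?\<phi> g \<in> rcosets\<^bsub>Fh Mod N\<^esub> W"
      using g by (auto simp: RCOSETS_def carrier_FactGroup)
    then show ?thesis unfolding eq by (rule W.rcosets_mult_eq)
  qed
  have "inj_on ?\<Theta> (carrier (Fh Mod L))"
  proof (rule inj_onI)
    fix C D assume CD: "C \<in> carrier (Fh Mod L)" "D \<in> carrier (Fh Mod L)" "?\<Theta> C = ?\<Theta> D"
    then obtain g h where gh: "g \<in> carrier Fh" "h \<in> carrier Fh"
      and C: "C = L #>\<^bsub>Fh\<^esub> g" and D: "D = L #>\<^bsub>Fh\<^esub> h"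
      by (auto simp: carrier_FactGroup)
    have "W #>\<^bsub>Fh Mod N\<^esub> ?\<phi> g = W #>\<^bsub>Fh Mod N\<^esub> ?\<phi> h"
      using CD(3) \<Theta> gh by (simp add: C D)
    then have "?\<phi> g \<in> W #>\<^bsub>Fh Mod N\<^esub> ?\<phi> h"
      using Q.rcos_self[OF _ W.is_subgroup, of "?\<phi> g"] gh by simp
    then obtain l where l: "l \<in> L" "?\<phi> g = ?\<phi> l <#>\<^bsub>Fh\<^esub> ?\<phi> h"
      by (auto simp: r_coset_def W_def)
    have "?\<phi> l <#>\<^bsub>Fh\<^esub> ?\<phi> h = ?\<phi> (l \<otimes>\<^bsub>Fh\<^esub> h)"
      by (rule N.rcos_sum) (use l gh in auto)
    with l(2) have "?\<phi> g = ?\<phi> (l \<otimes>\<^bsub>Fh\<^esub> h)" by (rule trans)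
    then obtain a where a: "a \<in> N" "g = a \<otimes>\<^bsub>Fh\<^esub> (l \<otimes>\<^bsub>Fh\<^esub> h)" using coset gh by blast
    then have "g = (a \<otimes>\<^bsub>Fh\<^esub> l) \<otimes>\<^bsub>Fh\<^esub> h" using l gh by (simp add: Fh.m_assoc)
    moreover have "a \<otimes>\<^bsub>Fh\<^esub> l \<in> L" using a l L(2) by auto
    ultimately have "g \<in> L #>\<^bsub>Fh\<^esub> h" by (auto simp: r_coset_def)
    then show "C = D"
      using Fh.repr_independence[OF _ gh(2) L.is_subgroup] by (simp add: C D)
  qed
  moreover have "?\<Theta> ` carrier (Fh Mod L) \<subseteq> carrier (Fh Mod N Mod W)"
  proof
    fix y assume "y \<in> ?\<Theta> ` carrier (Fh Mod L)"
    then obtain g where g: "g \<in> carrier Fh" "y = ?\<Theta> (L #>\<^bsub>Fh\<^esub> g)" by (auto simp: carrier_FactGroup)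
    then have "y = W #>\<^bsub>Fh Mod N\<^esub> ?\<phi> g" using \<Theta> by simp
    then show "y \<in> carrier (Fh Mod N Mod W)" using g(1) by (auto simp: carrier_FactGroup)
  qed
  moreover have "group_ring_map (padic_ring p) (Fh Mod L) (Fh Mod N Mod W) ?\<Theta> (f L) =
      \<zero>\<^bsub>group_ring (padic_ring p) (Fh Mod N Mod W)\<^esub>"
    using fun_cong[OF zero, of W] Wo pre
    by (simp add: completed_group_ring_map_def completed_group_ring_def Let_def)
  ultimately show ?thesis
    using group_ring_map_inj[OF padic_closed(4)[OF prime_p] completed_group_ring_comp_closed[OF f Lo]] C
    by blast
qed

lemma closure_of_T:
  assumes "S \<subseteq> carrier Fh"
  shows "g \<in> T closure_of S \<longleftrightarrow> g \<in> carrier Fh \<and> (\<forall>M\<in>I. \<exists>s\<in>S. s M = g M)"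
proof
  assume g: "g \<in> T closure_of S"
  have "\<exists>s\<in>S. s M = g M" if M: "M \<in> I" for M
  proof -
    have "openin T {h \<in> carrier Fh. h M = g M}" by (rule openin_compI[OF M]) auto
    moreover have "g \<in> {h \<in> carrier Fh. h M = g M}" using g by (simp add: in_closure_of)
    ultimately obtain s where "s \<in> S" "s \<in> {h \<in> carrier Fh. h M = g M}"
      using g unfolding in_closure_of by meson
    then show ?thesis by blast
  qed
  then show "g \<in> carrier Fh \<and> (\<forall>M\<in>I. \<exists>s\<in>S. s M = g M)" using g by (simp add: in_closure_of)
next
  assume g: "g \<in> carrier Fh \<and> (\<forall>M\<in>I. \<exists>s\<in>S. s M = g M)"
  show "g \<in> T closure_of S"
  proof (rule in_closure_T)
    fix M assume "M \<in> I"
    then obtain s where "s \<in> S" "s M = g M" using g by meson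
    then show "\<exists>s\<in>S. s \<in> carrier Fh \<and> s M = g M" using assms by (intro bexI[of _ s]) auto
  qed (use g in simp)
qed

lemma subgroup_closure_of:
  assumes "subgroup S Fh"
  shows "subgroup (T closure_of S) Fh"
proof -
  interpret S: subgroup S Fh by fact
  note cl = closure_of_T[OF S.subset]
  show ?thesis
  proof (rule Fh.subgroupI)
    show "T closure_of S \<subseteq> carrier Fh" using closure_of_subset_topspace[of T S] by simp
    show "T closure_of S \<noteq> {}" using S.one_closed cl by blast
  next
    fix g assume g: "g \<in> T closure_of S"
    have "\<exists>s\<in>S. s M = (inv\<^bsub>Fh\<^esub> g) M" if M: "M \<in> I" for M
    proof -
      interpret h: group_hom Fh "F Mod M" "\<lambda>g. g M" by (rule comp_group_hom[OF M])
      obtain s where "s \<in> S" "s M = g M" using g M unfolding cl by blast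
      moreover from this have "(inv\<^bsub>Fh\<^esub> s) M = (inv\<^bsub>Fh\<^esub> g) M" using h.hom_inv g cl by simp
      ultimately show ?thesis using S.m_inv_closed by blast
    qed
    then show "inv\<^bsub>Fh\<^esub> g \<in> T closure_of S" using g unfolding cl by simp
  next
    fix g h assume gh: "g \<in> T closure_of S" "h \<in> T closure_of S"
    have "\<exists>s\<in>S. s M = (g \<otimes>\<^bsub>Fh\<^esub> h) M" if M: "M \<in> I" for M
    proof -
      obtain s t where "s \<in> S" "s M = g M" "t \<in> S" "t M = h M" using gh M unfolding cl by meson
      then show ?thesis using M by (intro bexI[of _ "s \<otimes>\<^bsub>Fh\<^esub> t"]) simp_all
    qed
    then show "g \<otimes>\<^bsub>Fh\<^esub> h \<in> T closure_of S" using gh unfolding cl by simp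
  qed
qed

end

section \<open>Elements with vanishing Fox derivatives modulo \<open>N\<close>\<close>

theorem mainTheorem1:
  fixes p n :: nat and K :: "nat set"
    and v :: "pro_p_word"
    and N :: "pro_p_word set"
    and d :: "nat \<Rightarrow> pro_p_word cgr_elt \<Rightarrow> pro_p_word cgr_elt"
  assumes "prime p"
    and "K \<subseteq> {1..n}"
    and "v \<in> carrier (ProF p n)"
    and "N \<lhd> ProF p n" and "closedin (ProF_top p n) N"
    and "\<forall>k\<in>{1..n}. completed_fox_derivative p n k (d k)"
    and "\<forall>k\<in>{1..n} - K.
          ZpF_proj p n N (d k (completed_group_ring_of p (ProF p n) (ProF_top p n) v))
            = \<zero>\<^bsub>completed_group_ring p (ProF p n Mod N) (ProF_quot_top p n N)\<^esub>"
  shows "v \<in> ProF_top p n closure_of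
           ((ProF_sub p n K <#>\<^bsub>ProF p n\<^esub>
              normal_closure (ProF p n) (ProF_sub p n K \<inter> N)) <#>\<^bsub>ProF p n\<^esub>
            derived (ProF p n) N)"
proof -
  have "group (FG n)" unfolding FG_def by (rule group_free_group)
  then interpret pro_p "FG n" p
    using assms(1) by (intro pro_p.intro pro_p_axioms.intro)
  have Fh: "ProF p n = Fh" and T: "ProF_top p n = T"
    by (simp_all add: ProF_def ProF_top_def)
  note R = padic_closed[OF prime_p]
  have p0: "p > 0" using prime_gt_0_nat[OF prime_p] .
  define H where "H = ProF_sub p n K"
  define x where "x = ProF_gen p n"
  interpret \<iota>: group_hom "FG n" Fh "to_pro_p p (FG n)" by (rule to_pro_p_hom)
  have letter: "[(j, b)] \<in> carrier (FG n)" if "j \<in> {1..n}" for j b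
    using that by (simp add: FG_def free_group_def)
  have x: "x \<in> {1..n} \<rightarrow> carrier Fh"
    using letter by (simp add: x_def ProF_gen_def FG_gen_def)
  have xinv: "inv\<^bsub>Fh\<^esub> x j = to_pro_p p (FG n) [(j, False)]" if "j \<in> {1..n}" for j
    using inv_letter[OF that] \<iota>.hom_inv[OF letter[OF that, of True]]
    by (simp add: x_def ProF_gen_def FG_gen_def FG_def)
  have xK: "x ` K \<subseteq> carrier Fh" using x assms(2) by blast
  have gen: "subgroup (generate Fh (x ` K)) Fh" using Fh.generate_is_subgroup[OF xK] .
  have H_def': "H = T closure_of generate Fh (x ` K)"
    by (simp add: H_def ProF_sub_def Fh T x_def)
  have H: "subgroup H Fh" "closedin T H" "x ` K \<subseteq> H"
  proof -
    show "subgroup H Fh" unfolding H_def' by (rule subgroup_closure_of[OF gen])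
    show "closedin T H" unfolding H_def' by simp
    have "generate Fh (x ` K) \<subseteq> H"
      unfolding H_def' by (rule closure_of_subset) (use subgroup.subset[OF gen] in simp)
    then show "x ` K \<subseteq> H" by (auto intro: generate.incl)
  qed
  have N: "N \<lhd> Fh" "closedin T N" using assms(4,5) by (simp_all add: Fh T)
  have word_eq: "word_value Fh x w = to_pro_p p (FG n) w" if "w \<in> carrier (FG n)" for w
    using that
  proof (induction w)
    case Nil
    have "\<one>\<^bsub>FG n\<^esub> = []" by (simp add: FG_def free_group_def)
    then show ?case using \<iota>.hom_one by simp
  next
    case (Cons a u)
    obtain j b where a: "a = (j, b)" by force
    have j: "j \<in> {1..n}" using Cons.prems by (auto simp: a FG_def free_group_def)
    have u: "u \<in> carrier (FG n)"
      using suffix_FG[of u "a # u"] Cons.prems by (simp add: FG_def suffix_Cons)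
    have "a # u = [a] \<otimes>\<^bsub>FG n\<^esub> u"
      using Cons_eq_mult Cons.prems by (simp add: FG_def)
    then have "to_pro_p p (FG n) (a # u) = to_pro_p p (FG n) [a] \<otimes>\<^bsub>Fh\<^esub> to_pro_p p (FG n) u"
      using \<iota>.hom_mult[of "[a]" u] letter[OF j] u by (simp add: a)
    then show ?case
      using Cons.IH[OF u] xinv[OF j] by (simp add: a x_def ProF_gen_def FG_gen_def)
  qed
  have "v \<in> T closure_of ((H <#>\<^bsub>Fh\<^esub> normal_closure Fh (H \<inter> N)) <#>\<^bsub>Fh\<^esub> derived Fh N)"
  proof (rule in_closure_T)
    show v: "v \<in> carrier Fh" using assms(3) by (simp add: Fh)
    fix M assume M: "M \<in> I"
    obtain M' m where M': "M' \<in> I" "M' \<subseteq> M"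
      and near: "\<And>w. set w \<subseteq> {1..n} \<times> UNIV \<Longrightarrow>
        (\<And>k C. k \<in> {1..n} - K \<Longrightarrow> C \<in> carrier (Fh Mod (N <#>\<^bsub>Fh\<^esub> U M')) \<Longrightarrow>
          int (p ^ m) dvd fox_count (\<lambda>u. (N <#>\<^bsub>Fh\<^esub> U M') #>\<^bsub>Fh\<^esub> word_value Fh x u) k w C) \<Longrightarrow>
        \<exists>s\<in>(H <#>\<^bsub>Fh\<^esub> normal_closure Fh (H \<inter> N)) <#>\<^bsub>Fh\<^esub> derived Fh N.
          s \<in> carrier Fh \<and> s M = word_value Fh x w M"
      using word_near_product[OF N H(1,2) _ x assms(2) H(3) M] by (metis finite_atLeastAtMost)
    define L where "L = N <#>\<^bsub>Fh\<^esub> U M'"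
    have L: "L \<lhd> Fh" "openin T L" "finite (carrier (Fh Mod L))"
      unfolding L_def using Fh.normal_subgroup_set_mult_closed[OF N(1) U_normal[OF M'(1)]]
        open_mult_U[OF N(1) M'(1)] finite_index_mult_U[OF N(1) M'(1)] by auto
    have NL: "N \<subseteq> L"
      unfolding L_def normal_mult_U[OF N(1) M'(1)]
      using normal_imp_subgroup[OF N(1)] subgroup.mem_carrier by fastforce
    have Lo: "L \<in> open_normals Fh T" using L by (simp add: open_normals_def)
    let ?j = "completed_group_ring_of p Fh T"
    let ?P = "({1..n} - K) \<times> carrier (Fh Mod L)"
    \<comment> \<open>An open set around \<open>v\<close>; only finitely many coefficients are involved, since \<open>L\<close> has finite
      index. A word in it has its Fox derivatives divisible by \<open>p\<^sup>m\<close> at level \<open>L\<close>.\<close>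
    define O' where "O' = {g \<in> topspace T. \<forall>z\<in>?P. d (fst z) (?j g) L (snd z) m = 0}"
    have cont: "continuous_map T (completed_group_ring_topology p Fh T) (\<lambda>g. d k (?j g))"
      if "k \<in> {1..n}" for k
    proof -
      have "continuous_map (completed_group_ring_topology p Fh T) (completed_group_ring_topology p Fh T) (d k)"
        using assms(6) that by (simp add: completed_fox_derivative_def Fh T)
      from continuous_map_compose[OF continuous_completed_group_ring_of this]
      show ?thesis by (simp add: o_def)
    qed
    have "openin T O'"
      unfolding O'_def
    proof (rule openin_ball_finite)
      show "finite ?P" using L by simp
      fix z assume z: "z \<in> ?P"
      then have "continuous_map T (discrete_topology {0..<int p ^ m}) (\<lambda>g. d (fst z) (?j g) L (snd z) m)"
        using continuous_map_compose[OF cont continuous_coefficient[OF Lo], of "fst z" "snd z" m]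
        by (auto simp: o_def)
      then have "openin T {g \<in> topspace T. d (fst z) (?j g) L (snd z) m \<in> {0}}"
        by (rule openin_continuous_map_preimage) (use p0 in simp)
      then show "openin T {g \<in> topspace T. d (fst z) (?j g) L (snd z) m = 0}" by simp
    qed
    moreover have "v \<in> O'"
    proof -
      have "d k (?j v) L C m = 0" if k: "k \<in> {1..n} - K" and C: "C \<in> carrier (Fh Mod L)" for k C
      proof -
        have "d k (?j v) \<in> carrier (completed_group_ring p Fh T)"
          using continuous_map_image_subset_topspace[OF cont, of k] v k
          by (auto simp: topspace_completed_group_ring)
        moreover have "completed_group_ring_map p Fh (Fh Mod N)
            (quotient_topology T (\<lambda>g. N #>\<^bsub>Fh\<^esub> g)) (\<lambda>g. N #>\<^bsub>Fh\<^esub> g) (d k (?j v)) =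
          \<zero>\<^bsub>completed_group_ring p (Fh Mod N) (quotient_topology T (\<lambda>g. N #>\<^bsub>Fh\<^esub> g))\<^esub>"
          using assms(7) k by (simp add: ZpF_proj_def Fh T)
        ultimately have "d k (?j v) L C = \<zero>\<^bsub>padic_ring p\<^esub>"
          using projection_zero_imp_coefficient_zero[OF N(1) L(1) NL L(2)] C by blast
        then show ?thesis by (simp add: padic_zero padic_of_int_def)
      qed
      then show ?thesis using v by (auto simp: O'_def)
    qed
    ultimately obtain M1 where M1: "M1 \<in> I" "\<forall>h\<in>carrier Fh. h M1 = v M1 \<longrightarrow> h \<in> O'"
      unfolding openin_T by meson
    \<comment> \<open>The word has to agree with \<open>v\<close> at level \<open>M\<close> for the conclusion, and at level \<open>M1\<close> to be in \<open>O'\<close>.\<close>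
    have MM: "M \<inter> M1 \<in> I" using M M1 Int_in_I by blast
    obtain w where w: "w \<in> carrier (FG n)" "to_pro_p p (FG n) w (M \<inter> M1) = v (M \<inter> M1)"
      using to_pro_p_dense[OF v MM] by blast
    let ?g = "to_pro_p p (FG n) w"
    have g: "?g \<in> carrier Fh" using w by simp
    have gM: "?g M = v M" "?g M1 = v M1"
      using comp_eq_mono[OF g v MM _ _ w(2)] M M1 by auto
    have gO: "?g \<in> O'" using M1 g gM by blast
    have wX: "set w \<subseteq> {1..n} \<times> UNIV" using w by (simp add: FG_def free_group_def)
    let ?cls = "\<lambda>u. L #>\<^bsub>Fh\<^esub> word_value Fh x u"
    let ?cls' = "\<lambda>u. L #>\<^bsub>Fh\<^esub> to_pro_p p (FG n) u"
    have "int (p ^ m) dvd fox_count ?cls k w C"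
      if k: "k \<in> {1..n} - K" and C: "C \<in> carrier (Fh Mod L)" for k C
    proof -
      obtain D where D: "fox_derivative n k D"
        and dD: "\<forall>u\<in>carrier (group_ring \<Z> (FG n)). d k (ZF_to_ZpF p n u) = ZF_to_ZpF p n (D u)"
        using assms(6) k unfolding completed_fox_derivative_def by blast
      let ?c = "fox_count (\<lambda>u. u) k w"
      have "ZF_to_ZpF p n (group_ring_of \<Z> (FG n) w) = ?j ?g"
      proof -
        have "(\<lambda>g\<in>carrier (FG n). padic_of_int p (group_ring_of \<Z> (FG n) w g)) =
            group_ring_of (padic_ring p) (FG n) w"
          by (auto simp: group_ring_of_def padic_one padic_zero)
        then show ?thesis
          unfolding ZF_to_ZpF_def completed_group_ring_of_def Fh T
          by (simp add: group_ring_map_of[OF R(4,1,3) w(1)])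
      qed
      moreover have "group_ring_of \<Z> (FG n) w \<in> carrier (group_ring \<Z> (FG n))"
        by (rule group_ring_of_closed) auto
      ultimately have "d k (?j ?g) = ZF_to_ZpF p n (D (group_ring_of \<Z> (FG n) w))"
        using dD by metis
      also have "D (group_ring_of \<Z> (FG n) w) = (\<lambda>z\<in>carrier (FG n). ?c z)"
        using k by (intro fox_derivative_word[OF D w(1)]) simp
      finally have dk: "d k (?j ?g) = ZF_to_ZpF p n (\<lambda>z\<in>carrier (FG n). ?c z)" .
      \<comment> \<open>The sum that defines the coefficient runs over \<open>?S\<close>, where the coefficient in \<open>\<int>\<^sub>p\<close> is non-zero;
        the one for \<open>fox_count\<close> runs over the suffixes. They agree modulo \<open>p\<^sup>m\<close>.\<close>
      let ?A = "{u. suffix u w}"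
      let ?S = "{u \<in> carrier (FG n). padic_of_int p (?c u) \<noteq> \<zero>\<^bsub>padic_ring p\<^esub> \<and> ?cls' u = C}"
      have finA: "finite ?A"
        by (rule finite_subset[of _ "set (suffixes w)"]) auto
      have suf: "u \<in> carrier (FG n)" if "suffix u w" for u
        using suffix_FG that w(1) by (simp add: FG_def)
      have SA: "?S \<subseteq> {u \<in> ?A. ?cls' u = C}"
        using fox_count_eq_0[of _ w k] by (auto simp: padic_zero)
      let ?f = "\<lambda>z\<in>carrier (FG n). padic_of_int p (?c z)"
      have fe: "(\<lambda>g\<in>carrier (FG n). padic_of_int p ((\<lambda>z\<in>carrier (FG n). ?c z) g)) = ?f"
        by (rule restrict_ext) simp
      have se: "{u \<in> carrier (FG n). ?f u \<noteq> \<zero>\<^bsub>padic_ring p\<^esub> \<and> ?cls' u = C} = ?S"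
        by auto
      have "0 = d k (?j ?g) L C m" using gO k C by (auto simp: O'_def)
      also have "\<dots> = finsum (padic_ring p) (\<lambda>z\<in>carrier (FG n). padic_of_int p (?c z)) ?S m"
        unfolding dk ZF_to_ZpF_def Fh T group_ring_map_def fe
        by (simp only: restrict_apply'[OF Lo] restrict_apply'[OF C] se)
      also have "\<dots> = (\<Sum>u\<in>?S. (\<lambda>z\<in>carrier (FG n). padic_of_int p (?c z)) u m) mod int p ^ m"
        by (rule finsum_padic[OF p0]) (use padic_of_int_closed[OF p0] in auto)
      also have "(\<Sum>u\<in>?S. (\<lambda>z\<in>carrier (FG n). padic_of_int p (?c z)) u m) =
          (\<Sum>u\<in>{u \<in> ?A. ?cls' u = C}. ?c u mod int p ^ m)"
      proof (rule sum.mono_neutral_cong_left)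
        show "finite {u \<in> ?A. ?cls' u = C}" using finA by simp
        show "\<forall>u\<in>{u \<in> ?A. ?cls' u = C} - ?S. ?c u mod int p ^ m = 0"
          using suf by (auto simp: padic_zero padic_of_int_def fun_eq_iff)
      qed (use SA in \<open>auto simp: padic_of_int_def\<close>)
      also have "(\<Sum>u\<in>{u \<in> ?A. ?cls' u = C}. ?c u mod int p ^ m) mod int p ^ m =
          (\<Sum>u\<in>{u \<in> ?A. ?cls' u = C}. ?c u) mod int p ^ m"
        by (rule mod_sum_eq)
      also have "(\<Sum>u\<in>{u \<in> ?A. ?cls' u = C}. ?c u) = fox_count ?cls' k w C"
        by (rule fox_count_eq_sum[symmetric]) (use finA in auto)
      also have "fox_count ?cls' k w C = fox_count ?cls k w C"
        by (rule fox_count_cong) (use suf word_eq in simp)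
      finally show ?thesis by (simp add: dvd_eq_mod_eq_0)
    qed
    then show "\<exists>s\<in>(H <#>\<^bsub>Fh\<^esub> normal_closure Fh (H \<inter> N)) <#>\<^bsub>Fh\<^esub> derived Fh N.
        s \<in> carrier Fh \<and> s M = v M"
      using near[OF wX] word_eq[OF w(1)] gM(1) unfolding L_def by simp
  qed
  then show ?thesis by (simp only: Fh T H_def)
qed

end
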